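(* Let $\Omega\subset\mathbb{R}^3$ be an open bounded pathwise connected domain with polytopal boundary, and let $\chi,\chi_b$ be the topological parameters of $\overline\Omega$ (Euler characteristics of $\overline\Omega$ and of $\partial\Omega$). Let $\mathcal{T}_0$ be a conforming simplicial (tetrahedral) triangulation of $\overline\Omega$ with at least one interior vertex, and let $\mathcal{R}$ be a uniform mesh refinement scheme, mapping conforming tetrahedral meshes $\mathcal{T}$ to conforming tetrahedral meshes $\mathcal{T}'=\mathcal{R}(\mathcal{T})$ that refine them, with the properties: (R1) each tetrahedron of $\mathcal{T}$ is split into $8$ tetrahedra, each face of $\mathcal{T}$ is split into $4$ faces and each edge of $\mathcal{T}$ is split into $2$ edges; (R2) the vertices of $\mathcal{T}'$ are exactly the vertices of $\mathcal{T}$ and all the midpoints of edges of $\mathcal{T}$. Let $\mathcal{T}_n=\mathcal{R}(\mathcal{T}_{n-1})$ for $n\geq 1$, and let $\overline{e}_n$ be the average number of edges emanating from a vertex of $\mathcal{T}_n$. Then for all $n\geq 1$ $$\overline{e}_n\leq 18+\tfrac{2}{15}\max(0,\,7\chi+4\chi_b-96).$$ In particular, if $7\chi+4\chi_b\leq 96$, then $\overline{e}_n\leq 18$ for all $n\geq 1$.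
   Context: A conforming tetrahedral triangulation of $\overline\Omega$ is a finite set of closed non-degenerate tetrahedra whose union is $\overline\Omega$ and such that any two distinct tetrahedra intersect in the empty set, a common vertex, a common edge or a common (triangular) face. For a mesh with $V$ vertices, $E$ edges, $F$ faces, $T$ tetrahedra and with $V_b,E_b,F_b$ vertices, edges, faces contained in $\partial\Omega$ one has $V-E+F-T=\chi$ and $V_b-E_b+F_b=\chi_b$. As standing conventions on meshes: every boundary face belongs to exactly one tetrahedron, every other face belongs to exactly two tetrahedra, and every boundary edge belongs to exactly two boundary faces (so $2F-F_b=4T$ and $3F_b=2E_b$). A vertex is interior if it does not lie on $\partial\Omega$. With $e_i$ the number of edges having the vertex $v_i$ as an endpoint, the average is $\overline{e}=\frac1V\sum_{i=1}^Ve_i=2E/V$. *)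

theory Defs
  imports "HOL-Analysis.Analysis" "HOL-Homology.Homology"
begin

text \<open>The Euler characteristic of a space is the alternating sum of its Betti numbers, where the
  Betti numbers are the ranks of the integral singular homology groups.  The rank of an abelian group
  is the largest cardinality of a finite family that is linearly independent over the integers
  (torsion elements are never part of such a family).  For the compact polyhedra considered
  here all ranks are finite and only finitely many are nonzero, so that neither the supremum on
  \<^typ>\<open>nat\<close> nor the sum over a set of indices degenerates.\<close>

definition int_independent :: "('a, 'b) monoid_scheme \<Rightarrow> 'a set \<Rightarrow> bool" where
  "int_independent G B \<longleftrightarrow>
     finite B \<and> B \<subseteq> carrier G \<and>
     (\<forall>c :: 'a \<Rightarrow> int. finprod G (\<lambda>b. b [^]\<^bsub>G\<^esub> c b) B = \<one>\<^bsub>G\<^esub> \<longrightarrow> (\<forall>b\<in>B. c b = 0))"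

definition abelian_rank :: "('a, 'b) monoid_scheme \<Rightarrow> nat" where
  "abelian_rank G = Sup {card B | B. int_independent G B}"

definition betti_number :: "nat \<Rightarrow> 'a topology \<Rightarrow> nat" where
  "betti_number p X = abelian_rank (homology_group (int p) X)"

definition Euler_characteristic :: "'a topology \<Rightarrow> int" where
  "Euler_characteristic X =
     (\<Sum>p | betti_number p X \<noteq> 0. (- 1) ^ p * int (betti_number p X))"

definition polytopal_boundary :: "(real^3) set \<Rightarrow> bool" where
  "polytopal_boundary \<Omega> \<longleftrightarrow>
     (\<exists>\<P>. finite \<P> \<and> (\<forall>P\<in>\<P>. polytope P \<and> aff_dim P = 2) \<and> frontier \<Omega> = \<Union>\<P>)"

text \<open>A mesh is represented by its set of closed tetrahedra; its vertices, edges and (triangular)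
  faces are those of its tetrahedra.\<close>

definition mesh_vertices :: "(real^3) set set \<Rightarrow> (real^3) set" where
  "mesh_vertices \<T> = {v. \<exists>t\<in>\<T>. v extreme_point_of t}"

definition mesh_edges :: "(real^3) set set \<Rightarrow> (real^3) set set" where
  "mesh_edges \<T> = {e. \<exists>t\<in>\<T>. e edge_of t}"

definition mesh_faces :: "(real^3) set set \<Rightarrow> (real^3) set set" where
  "mesh_faces \<T> = {f. \<exists>t\<in>\<T>. f facet_of t}"

definition conforming_triangulation :: "(real^3) set \<Rightarrow> (real^3) set set \<Rightarrow> bool" where
  "conforming_triangulation \<Omega> \<T> \<longleftrightarrow>
     finite \<T> \<and> (\<forall>t\<in>\<T>. 3 simplex t) \<and> \<Union>\<T> = closure \<Omega> \<and>
     (\<forall>s\<in>\<T>. \<forall>t\<in>\<T>. s \<noteq> t \<longrightarrow>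
        s \<inter> t = {} \<or>
        (\<exists>v. s \<inter> t = {v} \<and> v extreme_point_of s \<and> v extreme_point_of t) \<or>
        (s \<inter> t edge_of s \<and> s \<inter> t edge_of t) \<or>
        (s \<inter> t facet_of s \<and> s \<inter> t facet_of t))"

definition mesh_conventions :: "(real^3) set \<Rightarrow> (real^3) set set \<Rightarrow> bool" where
  "mesh_conventions \<Omega> \<T> \<longleftrightarrow>
     (\<forall>f\<in>mesh_faces \<T>. f \<subseteq> frontier \<Omega> \<longrightarrow> card {t\<in>\<T>. f facet_of t} = 1) \<and>
     (\<forall>f\<in>mesh_faces \<T>. \<not> f \<subseteq> frontier \<Omega> \<longrightarrow> card {t\<in>\<T>. f facet_of t} = 2) \<and>
     (\<forall>e\<in>mesh_edges \<T>. e \<subseteq> frontier \<Omega> \<longrightarrow>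
        card {f\<in>mesh_faces \<T>. f \<subseteq> frontier \<Omega> \<and> e edge_of f} = 2)"

definition conforming_mesh :: "(real^3) set \<Rightarrow> (real^3) set set \<Rightarrow> bool" where
  "conforming_mesh \<Omega> \<T> \<longleftrightarrow> conforming_triangulation \<Omega> \<T> \<and> mesh_conventions \<Omega> \<T>"

definition mesh_refines :: "(real^3) set set \<Rightarrow> (real^3) set set \<Rightarrow> bool" where
  "mesh_refines \<T>' \<T> \<longleftrightarrow> \<Union>\<T>' = \<Union>\<T> \<and> (\<forall>t'\<in>\<T>'. \<exists>t\<in>\<T>. t' \<subseteq> t)"

text \<open>The set \<open>s\<close> is the union of exactly \<open>k\<close> members of the family \<open>\<S>\<close>, namely of all those
  contained in it.\<close>

definition split_into :: "'a set \<Rightarrow> nat \<Rightarrow> 'a set set \<Rightarrow> bool" where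
  "split_into s k \<S> \<longleftrightarrow> card {s'\<in>\<S>. s' \<subseteq> s} = k \<and> \<Union>{s'\<in>\<S>. s' \<subseteq> s} = s"

definition uniform_splitting :: "(real^3) set set \<Rightarrow> (real^3) set set \<Rightarrow> bool" where
  "uniform_splitting \<T> \<T>' \<longleftrightarrow>
     (\<forall>t\<in>\<T>. split_into t 8 \<T>') \<and>
     (\<forall>f\<in>mesh_faces \<T>. split_into f 4 (mesh_faces \<T>')) \<and>
     (\<forall>e\<in>mesh_edges \<T>. split_into e 2 (mesh_edges \<T>'))"

definition midpoint_vertices :: "(real^3) set set \<Rightarrow> (real^3) set set \<Rightarrow> bool" where
  "midpoint_vertices \<T> \<T>' \<longleftrightarrow>
     mesh_vertices \<T>' =
       mesh_vertices \<T> \<union> {midpoint a b | a b. closed_segment a b \<in> mesh_edges \<T>}"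

definition uniform_refinement_scheme ::
    "(real^3) set \<Rightarrow> ((real^3) set set \<Rightarrow> (real^3) set set) \<Rightarrow> bool" where
  "uniform_refinement_scheme \<Omega> \<R> \<longleftrightarrow>
     (\<forall>\<T>. conforming_mesh \<Omega> \<T> \<longrightarrow>
        conforming_mesh \<Omega> (\<R> \<T>) \<and> mesh_refines (\<R> \<T>) \<T> \<and>
        uniform_splitting \<T> (\<R> \<T>) \<and> midpoint_vertices \<T> (\<R> \<T>))"

definition vertex_degree :: "(real^3) set set \<Rightarrow> real^3 \<Rightarrow> nat" where
  "vertex_degree \<T> v = card {e\<in>mesh_edges \<T>. v extreme_point_of e}"

definition average_degree :: "(real^3) set set \<Rightarrow> real" where
  "average_degree \<T> =
     (\<Sum>v\<in>mesh_vertices \<T>. real (vertex_degree \<T> v)) / real (card (mesh_vertices \<T>))"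

end

theory Submission
  imports Defs
begin

text \<open>With at least one refinement the average degree is at most \<open>18\<close>, and both claims follow because
  \<open>18 + 2 / 15 * max 0 x\<close> is never smaller.  The average degree is \<open>2 E' / V'\<close> for the
  numbers \<open>V'\<close>, \<open>E'\<close>, \<open>F'\<close>, \<open>T'\<close> of vertices, edges, faces and tetrahedra of the refined mesh, so
  \<open>E' \<le> 9 V'\<close> has to be shown.  Let \<open>V\<close>, \<open>E\<close>, \<open>F\<close>, \<open>T\<close> be the numbers for the mesh before the last
  refinement, and \<open>B\<close>, \<open>B'\<close> the numbers of faces that lie in one tetrahedron only.

  The refined numbers are controlled by \<open>T' = 8 T\<close>, \<open>V' \<ge> V + E\<close> and \<open>B' \<le> 4 B\<close>, by the double count
  \<open>4 T + B = 2 F\<close> in each mesh, and by the equality of \<open>V - E + F - T\<close> for both meshes.  The last fact is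
  combinatorial rather than homological: the two meshes partition the same set into relatively open
  simplices, and the alternating number of cells of such a partition depends on the set only
  (\<open>Euler_relation\<close>, \<open>euler_invariant\<close>).  The proof cuts the cells by parallel hyperplanes and reduces the
  claim to intervals on a line.

  These facts bound \<open>E'\<close> by the old numbers, and the bound suffices as soon as \<open>F \<le> 2 E\<close>
  (\<open>card_faces_le\<close>).  That inequality is local.  On a small sphere around a vertex the edges appear as
  points and the faces as arcs that do not cross, that is, as a simple planar graph, and such a graph with
  \<open>n\<close> vertices has at most \<open>3 n\<close> edges (\<open>card_arcs_le\<close>).  Summation over the vertices of the mesh
  gives \<open>3 F \<le> 3 (2 E)\<close>.  For arcs of great circles the planar bound has an elementary proof: a
  half-plane rotates about an axis through the vertex, and each arc is charged to a point that is met later,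
  at most two arcs to each point, except for one uppermost arc per starting point.\<close>

section \<open>Arcs on a sphere that do not cross\<close>

text \<open>The sign of \<open>cross2 u v\<close> tells on which side of the line through \<open>u\<close> the vector \<open>v\<close> lies: positive
  means that the turn from \<open>u\<close> to \<open>v\<close> is counterclockwise and smaller than \<open>\<pi>\<close>.  All comparisons of
  directions in the plane below are made with these signs, so that no angles occur.\<close>

definition cross2 :: "real \<times> real \<Rightarrow> real \<times> real \<Rightarrow> real" where
  "cross2 u v = fst u * snd v - snd u * fst v"

lemma cross2_simps [simp]:
  "cross2 u u = 0"
  "cross2 (u + v) w = cross2 u w + cross2 v w" "cross2 w (u + v) = cross2 w u + cross2 w v"
  "cross2 (s *\<^sub>R u) w = s * cross2 u w" "cross2 w (s *\<^sub>R u) = s * cross2 w u"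
  by (simp_all add: cross2_def algebra_simps)

lemma cross2_swap: "cross2 v u = - cross2 u v"
  by (simp add: cross2_def)

text \<open>The three-term Pluecker relation; it turns two known turns into a third one.\<close>

lemma cross2_pluecker: "cross2 a c * cross2 b d = cross2 a b * cross2 c d + cross2 a d * cross2 b c"
  by (simp add: cross2_def algebra_simps)

lemma cross2_relation: "cross2 u v *\<^sub>R w + cross2 v w *\<^sub>R u + cross2 w u *\<^sub>R v = 0"
  by (simp add: cross2_def prod_eq_iff algebra_simps)

lemma cross2_zero_imp_parallel:
  assumes "cross2 l u > 0" "cross2 l v > 0" "cross2 u v = 0"
  shows "\<exists>s>0. u = s *\<^sub>R v"
proof -
  have "cross2 v l *\<^sub>R u + cross2 l u *\<^sub>R v = 0" using cross2_relation[of u v l] assms(3) by simp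
  then have "cross2 l v *\<^sub>R u = cross2 l u *\<^sub>R v"
    by (simp add: cross2_swap[of v l])
  then have "u = (cross2 l u / cross2 l v) *\<^sub>R v"
    using assms by (metis divide_inverse_commute less_irrefl real_vector.scale_left_imp_eq
        scaleR_scaleR right_inverse mult.commute nonzero_divide_eq_eq)
  then show ?thesis using assms by (intro exI[of _ "cross2 l u / cross2 l v"]) auto
qed

definition quarter :: "real \<times> real \<Rightarrow> real \<times> real" where
  "quarter u = (- snd u, fst u)"

lemma cross2_quarter_pos: "u \<noteq> 0 \<Longrightarrow> cross2 u (quarter u) > 0"
  by (cases u) (auto simp: cross2_def quarter_def sum_squares_gt_zero_iff zero_prod_def)


text \<open>The combinatorics around a vertex of a mesh.  The elements of \<open>P\<close> are the edges at the vertex and \<open>A\<close>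
  its faces; \<open>shadow\<close> and \<open>height\<close> are the planar and the vertical part of the direction of an edge.
  On a small sphere around the vertex the edges are points and the faces are arcs between them, and the
  direction of the shadow is the geographical longitude.  A face is the pair of its edges, the western one
  first.  The assumptions say that no two points have the same longitude and that the open arcs avoid the
  points and each other, where points of a cone are compared through their positive coefficients.\<close>

locale arc_system =
  fixes P :: "'a set" and A :: "('a \<times> 'a) set"
    and shadow :: "'a \<Rightarrow> real \<times> real" and height :: "'a \<Rightarrow> real"
  assumes finite_P: "finite P"
    and A_sub: "A \<subseteq> P \<times> P"
    and orient: "(l, r) \<in> A \<Longrightarrow> cross2 (shadow l) (shadow r) > 0"
    and distinct_longitudes:
      "p \<in> P \<Longrightarrow> q \<in> P \<Longrightarrow> s > 0 \<Longrightarrow> shadow p = s *\<^sub>R shadow q \<Longrightarrow> p = q"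
    and off_arc:
      "(l, r) \<in> A \<Longrightarrow> w \<in> P \<Longrightarrow> s > 0 \<Longrightarrow> t > 0 \<Longrightarrow>
       shadow w = s *\<^sub>R shadow l + t *\<^sub>R shadow r \<Longrightarrow> height w \<noteq> s * height l + t * height r"
    and noncrossing:
      "(l, r) \<in> A \<Longrightarrow> (l', r') \<in> A \<Longrightarrow> s > 0 \<Longrightarrow> t > 0 \<Longrightarrow> s' > 0 \<Longrightarrow> t' > 0 \<Longrightarrow>
       s *\<^sub>R shadow l + t *\<^sub>R shadow r = s' *\<^sub>R shadow l' + t' *\<^sub>R shadow r' \<Longrightarrow>
       s * height l + t * height r = s' * height l' + t' * height r' \<Longrightarrow> (l, r) = (l', r')"
begin

text \<open>The vertical half-plane in direction \<open>u\<close> meets the interior of the arc \<open>f\<close>.\<close>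

definition over :: "'a \<times> 'a \<Rightarrow> real \<times> real \<Rightarrow> bool" where
  "over f u \<longleftrightarrow> cross2 (shadow (fst f)) u > 0 \<and> cross2 u (shadow (snd f)) > 0"

text \<open>The height of the plane of the face \<open>f\<close> above the point \<open>u\<close>, by Cramer's rule.  It is linear in \<open>u\<close>,
  which replaces all continuity arguments below.\<close>

definition elev :: "'a \<times> 'a \<Rightarrow> real \<times> real \<Rightarrow> real" where
  "elev f u = (height (fst f) * cross2 u (shadow (snd f)) + height (snd f) * cross2 (shadow (fst f)) u)
              / cross2 (shadow (fst f)) (shadow (snd f))"

lemma elev_linear [simp]:
  "elev f (u + v) = elev f u + elev f v" "elev f (s *\<^sub>R u) = s * elev f u"
  by (simp_all add: elev_def add_divide_distrib algebra_simps)

lemma elev_ends: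
  assumes "(l, r) \<in> A"
  shows "elev (l, r) (shadow l) = height l" "elev (l, r) (shadow r) = height r"
  using orient[OF assms] by (simp_all add: elev_def)

lemma over_decomp:
  assumes "(l, r) \<in> A" "over (l, r) u"
  obtains s t where "s > 0" "t > 0" "u = s *\<^sub>R shadow l + t *\<^sub>R shadow r"
    "elev (l, r) u = s * height l + t * height r"
proof
  let ?c = "cross2 (shadow l) (shadow r)"
  have c: "?c > 0" using orient assms by auto
  show "cross2 u (shadow r) / ?c > 0" "cross2 (shadow l) u / ?c > 0"
    using assms c by (auto simp: over_def)
  have "?c *\<^sub>R u = cross2 u (shadow r) *\<^sub>R shadow l + cross2 (shadow l) u *\<^sub>R shadow r"
    using cross2_relation[of "shadow l" "shadow r" u]
    by (simp add: cross2_swap[of "shadow r" u] cross2_swap[of u "shadow l"] algebra_simps)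
  then have "u = (1 / ?c) *\<^sub>R (cross2 u (shadow r) *\<^sub>R shadow l + cross2 (shadow l) u *\<^sub>R shadow r)"
    using c by (metis divide_self_if less_irrefl scaleR_one scaleR_scaleR times_divide_eq_left mult_1)
  then show "u = (cross2 u (shadow r) / ?c) *\<^sub>R shadow l + (cross2 (shadow l) u / ?c) *\<^sub>R shadow r"
    by (simp add: algebra_simps)
  show "elev (l, r) u = cross2 u (shadow r) / ?c * height l + cross2 (shadow l) u / ?c * height r"
    by (simp add: elev_def add_divide_distrib mult.commute)
qed

lemma elev_neq_vertex:
  assumes "f \<in> A" "w \<in> P" "over f (shadow w)"
  shows "elev f (shadow w) \<noteq> height w"
proof -
  obtain l r where f: "f = (l, r)" by fastforce
  with assms obtain s t where "s > 0" "t > 0" "shadow w = s *\<^sub>R shadow l + t *\<^sub>R shadow r"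
    "elev (l, r) (shadow w) = s * height l + t * height r"
    using over_decomp by metis
  then show ?thesis using off_arc[of l r w s t] assms f by auto
qed

lemma elev_neq_arc:
  assumes "f \<in> A" "g \<in> A" "over f u" "over g u" "elev f u = elev g u"
  shows "f = g"
proof -
  obtain l r l' r' where f: "f = (l, r)" "g = (l', r')" by fastforce
  obtain s t where 1: "s > 0" "t > 0" "u = s *\<^sub>R shadow l + t *\<^sub>R shadow r"
    "elev f u = s * height l + t * height r"
    using over_decomp f assms by metis
  obtain s' t' where 2: "s' > 0" "t' > 0" "u = s' *\<^sub>R shadow l' + t' *\<^sub>R shadow r'"
    "elev g u = s' * height l' + t' * height r'"
    using over_decomp f assms by metis
  show ?thesis using noncrossing[of l r l' r' s t s' t'] assms f 1 2 by auto
qed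

text \<open>If one arc is below another one at \<open>u\<close> and both exist all the way from \<open>u\<close> to \<open>v\<close>, it is still
  below at \<open>v\<close>, possibly touching there: otherwise the linear difference of the elevations would vanish at a
  point strictly in between, where the arcs would cross.\<close>

lemma order_persists:
  assumes "f \<in> A" "g \<in> A"
    and both: "\<And>s t. s > 0 \<Longrightarrow> t > 0 \<Longrightarrow> over f (s *\<^sub>R u + t *\<^sub>R v) \<and> over g (s *\<^sub>R u + t *\<^sub>R v)"
    and less: "elev f u < elev g u"
  shows "elev f v \<le> elev g v"
proof (rule ccontr)
  assume "\<not> elev f v \<le> elev g v"
  define a where "a = elev g u - elev f u"
  define b where "b = elev f v - elev g v"
  have ab: "a > 0" "b > 0" using \<open>\<not> _\<close> less by (auto simp: a_def b_def)
  have "elev f (b *\<^sub>R u + a *\<^sub>R v) = elev g (b *\<^sub>R u + a *\<^sub>R v)"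
    unfolding elev_linear by (simp add: a_def b_def algebra_simps)
  then have "f = g" using elev_neq_arc assms(1,2) both[OF ab(2,1)] by blast
  then show False using less by simp
qed

lemma same_longitude_eq:
  assumes "p \<in> P" "q \<in> P" "cross2 v (shadow p) > 0" "cross2 v (shadow q) > 0"
    "cross2 (shadow p) (shadow q) = 0"
  shows "p = q"
  using cross2_zero_imp_parallel[OF assms(3,4,5)] distinct_longitudes assms(1,2) by blast

text \<open>Arcs with the same western end \<open>l\<close> have elevations that agree at \<open>l\<close>, so their vertical order just
  east of \<open>l\<close> is the order of their values at any direction to the left of \<open>l\<close>; a quarter turn is one.\<close>

definition slope :: "'a \<times> 'a \<Rightarrow> real" where
  "slope f = elev f (quarter (shadow (fst f)))"

lemma slope_elev:
  assumes "(l, r) \<in> A" "(l, r') \<in> A"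
  shows "(elev (l, r') u - elev (l, r) u) * cross2 (shadow l) (quarter (shadow l))
       = (slope (l, r') - slope (l, r)) * cross2 (shadow l) u"
proof -
  let ?q = "quarter (shadow l)"
  \<comment> \<open>The difference of the elevations vanishes at \<open>shadow l\<close>; apply it to the linear relation of three planar vectors.\<close>
  have "elev (l, r') (cross2 (shadow l) ?q *\<^sub>R u + cross2 ?q u *\<^sub>R shadow l + cross2 u (shadow l) *\<^sub>R ?q)
      - elev (l, r) (cross2 (shadow l) ?q *\<^sub>R u + cross2 ?q u *\<^sub>R shadow l + cross2 u (shadow l) *\<^sub>R ?q)
      = elev (l, r') (0 *\<^sub>R 0) - elev (l, r) (0 *\<^sub>R 0)"
    by (simp only: cross2_relation) simp
  then show ?thesis
    unfolding elev_linear slope_def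
    using elev_ends(1)[OF assms(1)] elev_ends(1)[OF assms(2)]
    by (simp add: cross2_swap[of u "shadow l"] algebra_simps)
qed

lemma shadow_nonzero:
  assumes "(l, r) \<in> A" shows "shadow l \<noteq> 0"
  using orient[OF assms] by (auto simp: cross2_def)

lemma slope_less_iff:
  assumes "(l, r) \<in> A" "(l, r') \<in> A" "cross2 (shadow l) u > 0"
  shows "slope (l, r) < slope (l, r') \<longleftrightarrow> elev (l, r) u < elev (l, r') u"
proof -
  have "cross2 (shadow l) (quarter (shadow l)) > 0"
    using cross2_quarter_pos shadow_nonzero assms by blast
  then have "elev (l, r') u - elev (l, r) u > 0 \<longleftrightarrow> slope (l, r') - slope (l, r) > 0"
    using slope_elev[OF assms(1,2), of u] assms(3) 
    by (metis mult_pos_pos zero_less_mult_pos2)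
  then show ?thesis by simp
qed

text \<open>Close enough to the common western end, both arcs exist; being distinct, they differ there.\<close>

lemma slope_inj:
  assumes "(l, r) \<in> A" "(l, r') \<in> A" "slope (l, r) = slope (l, r')"
  shows "r = r'"
proof -
  have c: "cross2 (shadow l) (shadow r) > 0" "cross2 (shadow l) (shadow r') > 0" using orient assms by auto
  \<comment> \<open>\<open>K\<close> is so large that \<open>u\<close>, which leaves \<open>shadow l\<close> only slightly, is still west of \<open>shadow r'\<close>.\<close>
  define K where "K = 1 + \<bar>cross2 (shadow r) (shadow r')\<bar> / cross2 (shadow l) (shadow r')"
  have K: "K > 0" using c by (auto simp: K_def intro!: add_pos_nonneg)
  define u where "u = K *\<^sub>R shadow l + shadow r"
  have lu: "cross2 (shadow l) u > 0" using c by (simp add: u_def)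
  have "cross2 u (shadow r') = cross2 (shadow l) (shadow r') + \<bar>cross2 (shadow r) (shadow r')\<bar> + cross2 (shadow r) (shadow r')"
    using c by (simp add: u_def K_def algebra_simps)
  then have "cross2 u (shadow r') > 0" using c by linarith
  moreover have "cross2 u (shadow r) > 0" using c K by (simp add: u_def)
  moreover have "elev (l, r) u = elev (l, r') u"
    using slope_less_iff[OF assms(1,2) lu] slope_less_iff[OF assms(2,1) lu] assms(3) by linarith
  ultimately show ?thesis
    using elev_neq_arc[OF assms(1,2), of u] lu by (auto simp: over_def)
qed

definition topmost :: "('a \<times> 'a) set" where
  "topmost = {f \<in> A. \<forall>g\<in>A. fst g = fst f \<longrightarrow> slope g \<le> slope f}"

lemma card_topmost: "card topmost \<le> card P"
proof (rule card_inj_on_le)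
  show "inj_on fst topmost"
  proof (rule inj_onI)
    fix f g assume fg: "f \<in> topmost" "g \<in> topmost" "fst f = fst g"
    obtain l r r' where e: "f = (l, r)" "g = (l, r')" using fg(3) by (metis prod.collapse)
    have "slope f = slope g" using fg by (auto simp: topmost_def intro: antisym)
    then show "f = g" using slope_inj[of l r r'] e fg by (auto simp: topmost_def)
  qed
  show "fst ` topmost \<subseteq> P" using A_sub by (auto simp: topmost_def)
qed (rule finite_P)

definition next_arc :: "'a \<times> 'a \<Rightarrow> 'a \<times> 'a \<Rightarrow> bool" where
  "next_arc f g \<longleftrightarrow> g \<in> A \<and> fst g = fst f \<and> slope f < slope g \<and>
     (\<forall>k\<in>A. fst k = fst f \<longrightarrow> slope f < slope k \<longrightarrow> slope g \<le> slope k)"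

lemma finite_A: "finite A"
  using A_sub finite_P finite_subset by blast

lemma next_arc_exists:
  assumes "f \<in> A - topmost" shows "\<exists>g. next_arc f g"
proof -
  let ?G = "{g \<in> A. fst g = fst f \<and> slope f < slope g}"
  have "finite ?G" using finite_A by simp
  moreover obtain k where "k \<in> A" "fst k = fst f" "\<not> slope k \<le> slope f"
    using assms unfolding topmost_def by blast
  then have "k \<in> ?G" by simp
  then have "?G \<noteq> {}" by blast
  ultimately obtain g where "is_arg_min slope (\<lambda>g. g \<in> ?G) g"
    using ex_is_arg_min_if_finite[of ?G slope] by blast
  then have "g \<in> ?G" "\<forall>k\<in>?G. \<not> slope k < slope g" by (auto simp: is_arg_min_def)
  then have "next_arc f g" unfolding next_arc_def not_less by blast
  then show ?thesis ..
qed

text \<open>For an arc \<open>f\<close> and the arc \<open>g\<close> just above it at their common western end, the points that lie in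
  the closed region between \<open>f\<close> and \<open>g\<close>, up to the longitude where the shorter of the two arcs ends.\<close>

definition wedge :: "'a \<times> 'a \<Rightarrow> 'a \<times> 'a \<Rightarrow> 'a set" where
  "wedge f g = {w \<in> P. cross2 (shadow (fst f)) (shadow w) > 0 \<and>
     cross2 (shadow w) (shadow (snd f)) \<ge> 0 \<and> cross2 (shadow w) (shadow (snd g)) \<ge> 0 \<and>
     elev f (shadow w) \<le> height w \<and> height w \<le> elev g (shadow w)}"

text \<open>The westernmost such point: it is the first point that a half-plane meets between \<open>f\<close> and \<open>g\<close> when
  it rotates eastwards.\<close>

definition first_event :: "'a \<times> 'a \<Rightarrow> 'a \<times> 'a \<Rightarrow> 'a \<Rightarrow> bool" where
  "first_event f g w \<longleftrightarrow> w \<in> wedge f g \<and> (\<forall>w'\<in>wedge f g. cross2 (shadow w) (shadow w') \<ge> 0)"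

text \<open>The eastern end of the shorter of the two arcs is in the wedge.\<close>

lemma wedge_nonempty:
  assumes "f \<in> A" "next_arc f g"
  shows "wedge f g \<noteq> {}"
proof -
  obtain l r r' where e: "f = (l, r)" "g = (l, r')"
    using assms(2) by (metis next_arc_def prod.collapse)
  have A: "(l, r) \<in> A" "(l, r') \<in> A" "slope (l, r) < slope (l, r')"
    using assms e by (auto simp: next_arc_def)
  have c: "cross2 (shadow l) (shadow r) > 0" "cross2 (shadow l) (shadow r') > 0" using orient A by auto
  have P: "r \<in> P" "r' \<in> P" using A A_sub by auto
  show ?thesis
  proof (cases "cross2 (shadow r) (shadow r') \<ge> 0")
    case True
    have "elev (l, r) (shadow r) < elev (l, r') (shadow r)"
      using slope_less_iff[OF A(1,2) c(1)] A(3) by simp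
    then have "r \<in> wedge f g" using P c True elev_ends[OF A(1)] by (auto simp: wedge_def e)
    then show ?thesis by blast
  next
    case False
    then have "cross2 (shadow r') (shadow r) \<ge> 0" using cross2_swap[of "shadow r'" "shadow r"] by linarith
    moreover have "elev (l, r) (shadow r') < elev (l, r') (shadow r')"
      using slope_less_iff[OF A(1,2) c(2)] A(3) by simp
    ultimately have "r' \<in> wedge f g" using P c elev_ends[OF A(2)] by (auto simp: wedge_def e)
    then show ?thesis by blast
  qed
qed

lemma first_event_exists:
  assumes "f \<in> A" "next_arc f g"
  shows "\<exists>w. first_event f g w"
proof -
  obtain l r where e: "f = (l, r)" by fastforce
  \<comment> \<open>Among directions to the left of \<open>shadow l\<close>, a larger value of \<open>\<rho>\<close> means further east.\<close>
  define \<rho> where "\<rho> w = - cross2 (shadow w) (shadow r) / cross2 (shadow l) (shadow w)" for w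
  have "finite (wedge f g)" using finite_P by (auto simp: wedge_def)
  then obtain w where w: "is_arg_min \<rho> (\<lambda>w. w \<in> wedge f g) w"
    using ex_is_arg_min_if_finite[of "wedge f g" \<rho>] wedge_nonempty[OF assms] by blast
  have "cross2 (shadow w) (shadow w') \<ge> 0" if w': "w' \<in> wedge f g" for w'
  proof -
    have pos: "cross2 (shadow l) (shadow w) > 0" "cross2 (shadow l) (shadow w') > 0"
      "cross2 (shadow l) (shadow r) > 0"
      using w w' orient assms(1) by (auto simp: is_arg_min_def wedge_def e)
    have "\<rho> w \<le> \<rho> w'" using w w' by (auto simp: is_arg_min_def not_less)
    then have "cross2 (shadow w') (shadow r) * cross2 (shadow l) (shadow w)
             \<le> cross2 (shadow w) (shadow r) * cross2 (shadow l) (shadow w')"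
      using pos by (simp add: \<rho>_def divide_simps)
    then have "cross2 (shadow l) (shadow r) * cross2 (shadow w) (shadow w') \<ge> 0"
      by (simp add: cross2_def algebra_simps)
    then show ?thesis using pos by (simp add: zero_le_mult_iff)
  qed
  then show ?thesis using w by (auto simp: first_event_def is_arg_min_def)
qed

text \<open>No arc runs strictly between \<open>f\<close> and \<open>g\<close> at the longitude of the first event.  Follow such an arc
  \<open>k\<close> westwards; it stays between \<open>f\<close> and \<open>g\<close>.  If it passes the common western end of these two, it is
  pinched there and runs through a point.  If it starts at that end, \<open>g\<close> was not the next arc above \<open>f\<close>.
  If it starts later, its western end is an earlier event.\<close>

lemma wedge_empty_before_first_event:
  assumes "f \<in> A" "next_arc f g" "first_event f g w"
    and k: "k \<in> A" "over k (shadow w)"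
    and less: "elev f (shadow w) < elev k (shadow w)" "elev k (shadow w) < elev g (shadow w)"
  shows False
proof -
  obtain l r r' where e: "f = (l, r)" "g = (l, r')"
    using assms(2) by (metis next_arc_def prod.collapse)
  obtain p q where kpq: "k = (p, q)" by fastforce
  have A: "(l, r) \<in> A" "(l, r') \<in> A" "(p, q) \<in> A"
    using assms e kpq by (auto simp: next_arc_def)
  have lr: "cross2 (shadow l) (shadow r) > 0" "cross2 (shadow l) (shadow r') > 0"
    and pq: "cross2 (shadow p) (shadow q) > 0" using orient A by auto
  have w: "cross2 (shadow l) (shadow w) > 0" "cross2 (shadow w) (shadow r) \<ge> 0" "cross2 (shadow w) (shadow r') \<ge> 0"
    using assms(3) by (auto simp: first_event_def wedge_def e)
  have kw: "cross2 (shadow p) (shadow w) > 0" "cross2 (shadow w) (shadow q) > 0"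
    using k by (auto simp: over_def kpq)
  have P: "l \<in> P" "p \<in> P" using A A_sub by auto
  consider "cross2 (shadow p) (shadow l) > 0" | "cross2 (shadow p) (shadow l) = 0"
    | "cross2 (shadow l) (shadow p) > 0"
    using cross2_swap[of "shadow p" "shadow l"] by linarith
  then show False
  proof cases
    case 1
    have "cross2 (shadow p) (shadow w) * cross2 (shadow l) (shadow q) =
      cross2 (shadow p) (shadow l) * cross2 (shadow w) (shadow q) + cross2 (shadow p) (shadow q) * cross2 (shadow l) (shadow w)"
      using cross2_pluecker[of "shadow p" "shadow w" "shadow l" "shadow q"] by (simp add: algebra_simps)
    also have "\<dots> > 0" using 1 kw pq w by (intro add_pos_pos mult_pos_pos)
    finally have lq: "cross2 (shadow l) (shadow q) > 0" using kw(1) by (simp add: zero_less_mult_iff)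
    have okl: "over k (shadow l)" using 1 lq by (simp add: over_def kpq)
    have "elev f (shadow l) \<le> elev k (shadow l)"
      using assms(1) k(1)
    proof (rule order_persists[OF _ _ _ less(1)])
      fix s t :: real assume "s > 0" "t > 0"
      then show "over f (s *\<^sub>R shadow w + t *\<^sub>R shadow l) \<and> over k (s *\<^sub>R shadow w + t *\<^sub>R shadow l)"
        using 1 lq w kw lr by (auto simp: over_def e kpq intro!: add_pos_pos add_nonneg_pos)
    qed
    moreover have "elev k (shadow l) \<le> elev g (shadow l)"
      using k(1) A(2)[folded e]
    proof (rule order_persists[OF _ _ _ less(2)])
      fix s t :: real assume "s > 0" "t > 0"
      then show "over k (s *\<^sub>R shadow w + t *\<^sub>R shadow l) \<and> over g (s *\<^sub>R shadow w + t *\<^sub>R shadow l)"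
        using 1 lq w kw lr by (auto simp: over_def e kpq intro!: add_pos_pos add_nonneg_pos)
    qed
    ultimately have "elev k (shadow l) = height l"
      using elev_ends(1)[OF A(1)] elev_ends(1)[OF A(2)] e by simp
    then show False using elev_neq_vertex[OF k(1) P(1) okl] by simp
  next
    case 2
    have "cross2 (- shadow w) (shadow p) > 0" "cross2 (- shadow w) (shadow l) > 0"
      using kw(1) w(1) by (simp_all add: cross2_def mult.commute)
    then have "p = l" using same_longitude_eq[OF P(2,1) _ _ 2] by blast
    then have "slope f < slope k" "slope k < slope g"
      using slope_less_iff[of l r q "shadow w"] slope_less_iff[of l q r' "shadow w"] A w less
      by (auto simp: e kpq)
    then show False using assms(2) k(1) \<open>p = l\<close> by (force simp: next_arc_def e kpq)
  next
    case 3
    have between: "cross2 (shadow p) (shadow c) > 0"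
      if "cross2 (shadow l) (shadow c) > 0" "cross2 (shadow w) (shadow c) \<ge> 0" for c
    proof -
      have "cross2 (shadow l) (shadow w) * cross2 (shadow p) (shadow c) =
        cross2 (shadow l) (shadow p) * cross2 (shadow w) (shadow c) + cross2 (shadow l) (shadow c) * cross2 (shadow p) (shadow w)"
        using cross2_pluecker[of "shadow l" "shadow w" "shadow p" "shadow c"] by simp
      also have "\<dots> > 0" using 3 that kw by (intro add_nonneg_pos mult_pos_pos) auto
      finally show ?thesis using w(1) by (simp add: zero_less_mult_iff)
    qed
    have pr: "cross2 (shadow p) (shadow r) > 0" "cross2 (shadow p) (shadow r') > 0"
      using between lr w by auto
    have "elev f (shadow p) \<le> elev k (shadow p)"
      using assms(1) k(1)
    proof (rule order_persists[OF _ _ _ less(1)])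
      fix s t :: real assume "s > 0" "t > 0"
      then show "over f (s *\<^sub>R shadow w + t *\<^sub>R shadow p) \<and> over k (s *\<^sub>R shadow w + t *\<^sub>R shadow p)"
        using 3 w kw pr pq by (auto simp: over_def e kpq intro!: add_pos_pos add_nonneg_pos)
    qed
    moreover have "elev k (shadow p) \<le> elev g (shadow p)"
      using k(1) A(2)[folded e]
    proof (rule order_persists[OF _ _ _ less(2)])
      fix s t :: real assume "s > 0" "t > 0"
      then show "over k (s *\<^sub>R shadow w + t *\<^sub>R shadow p) \<and> over g (s *\<^sub>R shadow w + t *\<^sub>R shadow p)"
        using 3 w kw pr pq by (auto simp: over_def e kpq intro!: add_pos_pos add_nonneg_pos)
    qed
    ultimately have "p \<in> wedge f g"
      using P 3 pr elev_ends(1)[OF A(3)] by (auto simp: wedge_def e kpq)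
    then have "cross2 (shadow w) (shadow p) \<ge> 0" using assms(3) by (auto simp: first_event_def)
    then show False using kw(1) cross2_swap[of "shadow w" "shadow p"] by simp
  qed
qed

text \<open>With the preceding lemma, this makes \<open>f\<close> the highest arc below its first event if the event is not the
  eastern end of \<open>f\<close>, and the next lemma makes \<open>g\<close> the lowest arc above the event if it is.\<close>

lemma first_event_inside_lower:
  assumes "f \<in> A" "next_arc f g" "first_event f g w" "w \<noteq> snd f"
  shows "over f (shadow w)" "elev f (shadow w) < height w" "height w \<le> elev g (shadow w)"
proof -
  have w: "w \<in> P" "cross2 (shadow (fst f)) (shadow w) > 0" "cross2 (shadow w) (shadow (snd f)) \<ge> 0"
    "elev f (shadow w) \<le> height w" "height w \<le> elev g (shadow w)"
    using assms(3) by (auto simp: first_event_def wedge_def)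
  have "cross2 (shadow (fst f)) (shadow (snd f)) > 0" "snd f \<in> P"
    using orient[of "fst f" "snd f"] assms(1) A_sub by auto
  then have "cross2 (shadow w) (shadow (snd f)) \<noteq> 0" using same_longitude_eq w assms(4) by blast
  then show o: "over f (shadow w)" using w by (simp add: over_def)
  show "elev f (shadow w) < height w" "height w \<le> elev g (shadow w)"
    using elev_neq_vertex[OF assms(1) w(1) o] w by auto
qed

lemma first_event_inside_upper:
  assumes "f \<in> A" "next_arc f g" "first_event f g w" "w = snd f"
  shows "over g (shadow w)" "elev f (shadow w) = height w" "height w < elev g (shadow w)"
proof -
  have w: "w \<in> P" "cross2 (shadow (fst g)) (shadow w) > 0" "cross2 (shadow w) (shadow (snd g)) \<ge> 0"
    "height w \<le> elev g (shadow w)"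
    using assms(2,3) by (auto simp: first_event_def wedge_def next_arc_def)
  have g: "g \<in> A" "g \<noteq> f" "fst g = fst f" using assms(2) by (auto simp: next_arc_def)
  have "cross2 (shadow (fst g)) (shadow (snd g)) > 0" "snd g \<in> P"
    using orient[of "fst g" "snd g"] g A_sub by auto
  moreover have "snd g \<noteq> w" using g assms(4) by (auto simp: prod_eq_iff)
  ultimately have "cross2 (shadow w) (shadow (snd g)) \<noteq> 0" using same_longitude_eq w by blast
  then show o: "over g (shadow w)" using w by (simp add: over_def)
  show "elev f (shadow w) = height w" "height w < elev g (shadow w)"
    using elev_neq_vertex[OF g(1) w(1) o] w elev_ends[of "fst f" "snd f"] assms(1,4) by auto
qed

text \<open>The bound \<open>3 n\<close> for the number of edges of a planar graph, by a sweep.  Every point is the western end of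
  at most one topmost arc.  Any other arc \<open>f\<close> is charged to its first event \<open>w\<close>, together with the
  information whether \<open>w\<close> ends \<open>f\<close>.  This determines \<open>f\<close>: it is either the highest arc below \<open>w\<close>, or
  the arc to \<open>w\<close> from the western end of the lowest arc above \<open>w\<close>.  So there are at most \<open>2 n\<close> other
  arcs.  The argument is local in the longitude and hence does not mind that the sweep is cyclic.\<close>

theorem card_arcs_le: "card A \<le> 3 * card P"
proof -
  obtain N where N: "\<And>f. f \<in> A - topmost \<Longrightarrow> next_arc f (N f)"
    using next_arc_exists by metis
  obtain W where W: "\<And>f. f \<in> A - topmost \<Longrightarrow> first_event f (N f) (W f)"
  proof -
    have "\<forall>f. \<exists>w. f \<in> A - topmost \<longrightarrow> first_event f (N f) w"
      using first_event_exists N by blast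
    then show ?thesis using that by metis
  qed
  define \<Phi> where "\<Phi> f = (W f, W f = snd f)" for f
  have inj_lower: "elev f1 (shadow w) \<ge> elev f2 (shadow w)"
    if f: "f1 \<in> A - topmost" "f2 \<in> A - topmost" "W f1 = w" "W f2 = w" "w \<noteq> snd f1" "w \<noteq> snd f2" for f1 f2 w
  proof (rule ccontr)
    assume less: "\<not> ?thesis"
    have A: "f1 \<in> A" "f2 \<in> A" using f by auto
    have ev: "first_event f1 (N f1) w" "first_event f2 (N f2) w" using W f by metis+
    note lower1 = first_event_inside_lower[OF A(1) N[OF f(1)] ev(1) f(5)]
    note lower2 = first_event_inside_lower[OF A(2) N[OF f(2)] ev(2) f(6)]
    show False
      using wedge_empty_before_first_event[OF A(1) N[OF f(1)] ev(1) A(2) lower2(1)] lower1 lower2 less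
      by linarith
  qed
  have inj_upper: "elev (N f1) (shadow w) \<le> elev (N f2) (shadow w)"
    if f: "f1 \<in> A - topmost" "f2 \<in> A - topmost" "W f1 = w" "W f2 = w" "w = snd f1" "w = snd f2" for f1 f2 w
  proof (rule ccontr)
    assume less: "\<not> ?thesis"
    have A: "f1 \<in> A" "f2 \<in> A" using f by auto
    have ev: "first_event f1 (N f1) w" "first_event f2 (N f2) w" using W f by metis+
    note upper1 = first_event_inside_upper[OF A(1) N[OF f(1)] ev(1) f(5)]
    note upper2 = first_event_inside_upper[OF A(2) N[OF f(2)] ev(2) f(6)]
    have "N f2 \<in> A" using N[OF f(2)] by (simp add: next_arc_def)
    then show False
      using wedge_empty_before_first_event[OF A(1) N[OF f(1)] ev(1) _ upper2(1)] upper1 upper2 less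
      by linarith
  qed
  have "inj_on \<Phi> (A - topmost)"
  proof (rule inj_onI)
    fix f1 f2 assume f: "f1 \<in> A - topmost" "f2 \<in> A - topmost" "\<Phi> f1 = \<Phi> f2"
    define w where "w = W f1"
    have W12: "W f1 = w" "W f2 = w" using f(3) by (auto simp: \<Phi>_def w_def)
    have iff: "w = snd f1 \<longleftrightarrow> w = snd f2" using f(3) by (auto simp: \<Phi>_def w_def)
    have ev: "first_event f1 (N f1) w" "first_event f2 (N f2) w" using W f(1,2) W12 by metis+
    show "f1 = f2"
    proof (cases "w = snd f1")
      case False
      then have "elev f1 (shadow w) = elev f2 (shadow w)"
        using inj_lower[OF f(1,2) W12] inj_lower[OF f(2,1) W12(2,1)] iff by simp
      then show ?thesis
        using elev_neq_arc[of f1 f2] first_event_inside_lower(1)[of _ "N _" w] ev f N iff False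
        by (metis DiffD1)
    next
      case True
      then have "elev (N f1) (shadow w) = elev (N f2) (shadow w)"
        using inj_upper[OF f(1,2) W12] inj_upper[OF f(2,1) W12(2,1)] iff by simp
      moreover have "N f1 \<in> A" "N f2 \<in> A" using N f by (auto simp: next_arc_def)
      ultimately have "N f1 = N f2"
        using elev_neq_arc[of "N f1" "N f2"] first_event_inside_upper(1)[of _ "N _" w] ev f N iff True
        by (metis DiffD1)
      then have "fst f1 = fst f2" using N f by (metis next_arc_def)
      then show ?thesis using True iff by (simp add: prod_eq_iff)
    qed
  qed
  moreover have "\<Phi> ` (A - topmost) \<subseteq> P \<times> UNIV"
    using W by (auto simp: \<Phi>_def first_event_def wedge_def)
  ultimately have "card (A - topmost) \<le> card (P \<times> (UNIV :: bool set))"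
    using finite_P by (intro card_inj_on_le) auto
  then have "card (A - topmost) \<le> 2 * card P" by (simp add: card_cartesian_product)
  moreover have "card A = card (A - topmost) + card topmost"
    using card_Diff_subset[of topmost A] card_mono[of A topmost] finite_A
    by (auto simp: topmost_def)
  ultimately show ?thesis using card_topmost by linarith
qed

end

section \<open>The Euler characteristic as a valuation\<close>

text \<open>The one-dimensional case: to a function \<open>h\<close> that is a combination of indicators of points and bounded
  open intervals belongs the sum of the jumps \<open>h x - h (x + \<delta>)\<close> over all endpoints \<open>x\<close>, for a small
  \<open>\<delta>\<close>.  A point contributes \<open>1\<close> and an open interval \<open>-1\<close>, at its left end.\<close>

lemma interval_sum_eq_zero:
  fixes J :: "'i \<Rightarrow> real set" and c :: "'i \<Rightarrow> int"
  assumes "finite I"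
    and J: "\<And>i. i \<in> I \<Longrightarrow> (\<exists>a. J i = {a}) \<or> (\<exists>a b. a < b \<and> J i = {a<..<b})"
    and zero: "\<And>x. (\<Sum>i\<in>{i\<in>I. x \<in> J i}. c i) = 0"
  shows "(\<Sum>i\<in>I. c i * (if \<exists>a. J i = {a} then 1 else -1)) = 0"
proof -
  have "\<exists>X. finite X \<and> ((\<exists>a\<in>X. J i = {a}) \<or> (\<exists>a\<in>X. \<exists>b\<in>X. a < b \<and> J i = {a<..<b}))"
    if "i \<in> I" for i
  proof -
    from J[OF that] consider a where "J i = {a}" | a b where "a < b" "J i = {a<..<b}" by blast
    then show ?thesis
    proof cases
      case 1 then show ?thesis by (intro exI[of _ "{a}"]) auto
    next
      case 2 then show ?thesis by (intro exI[of _ "{a, b}"]) auto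
    qed
  qed
  then obtain E where E: "\<And>i. i \<in> I \<Longrightarrow> finite (E i)"
    "\<And>i. i \<in> I \<Longrightarrow> (\<exists>a\<in>E i. J i = {a}) \<or> (\<exists>a\<in>E i. \<exists>b\<in>E i. a < b \<and> J i = {a<..<b})"
    by metis
  define X where "X = (\<Union>i\<in>I. E i)"
  have finX: "finite X" using E(1) \<open>finite I\<close> by (auto simp: X_def)
  have JX: "(\<exists>a\<in>X. J i = {a}) \<or> (\<exists>a\<in>X. \<exists>b\<in>X. a < b \<and> J i = {a<..<b})" if "i \<in> I" for i
  proof -
    have "E i \<subseteq> X" using that by (auto simp: X_def)
    then show ?thesis using E(2)[OF that] by blast
  qed
  \<comment> \<open>\<open>\<delta>\<close> is smaller than every gap between two endpoints.\<close>
  obtain \<delta> where \<delta>: "\<delta> > 0" "\<And>x y. x \<in> X \<Longrightarrow> y \<in> X \<Longrightarrow> x < y \<Longrightarrow> x + \<delta> < y"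
  proof -
    define D where "D = insert 1 {y - x | x y. x \<in> X \<and> y \<in> X \<and> x < y}"
    have "finite {(x, y). x \<in> X \<and> y \<in> X \<and> x < y}"
      by (rule finite_subset[of _ "X \<times> X"]) (use finX in auto)
    then have "finite ((\<lambda>(x, y). y - x) ` {(x, y). x \<in> X \<and> y \<in> X \<and> x < y})" by blast
    moreover have "(\<lambda>(x, y). y - x) ` {(x, y). x \<in> X \<and> y \<in> X \<and> x < y} =
        {y - x | x y. x \<in> X \<and> y \<in> X \<and> x < y}" by force
    ultimately have D: "finite D" by (simp add: D_def)
    have "Min D > 0" using D by (auto simp: D_def Min_gr_iff)
    moreover have "Min D \<le> y - x" if "x \<in> X" "y \<in> X" "x < y" for x y
      using D that by (intro Min_le) (auto simp: D_def)
    ultimately show ?thesis by (intro that[of "Min D / 2"]) force+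
  qed
  have jump: "(\<Sum>x\<in>X. of_bool (x \<in> J i) - of_bool (x + \<delta> \<in> J i)) = (if \<exists>a. J i = {a} then 1 else -1 :: int)"
    if i: "i \<in> I" for i
  proof -
    from JX[OF i] consider a where "a \<in> X" "J i = {a}" | a b where "a \<in> X" "b \<in> X" "a < b" "J i = {a<..<b}" by blast
    then show ?thesis
    proof cases
      case 1
      have "x + \<delta> \<noteq> a" if "x \<in> X" for x
        using \<delta>(1) \<delta>(2)[OF that 1(1)] by (cases "x < a") auto
      then have "(\<Sum>x\<in>X. of_bool (x \<in> J i) - of_bool (x + \<delta> \<in> J i)) = (\<Sum>x\<in>X. if x = a then 1 else 0 :: int)"
        by (intro sum.cong) (auto simp: 1)
      then show ?thesis using 1 finX by simp
    next
      case 2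
      have nsing: "\<nexists>c. J i = {c}"
        unfolding 2 using \<open>a < b\<close> infinite_Ioo[of a b] by (metis finite.emptyI finite.insertI)
      have "x + \<delta> \<in> J i \<longleftrightarrow> x = a \<or> x \<in> J i" if "x \<in> X" for x
        using \<delta>(1) \<delta>(2)[OF that 2(1)] \<delta>(2)[OF that 2(2)] \<open>a < b\<close>
        by (auto simp: 2) (smt (verit))+
      then have "(\<Sum>x\<in>X. of_bool (x \<in> J i) - of_bool (x + \<delta> \<in> J i)) = (\<Sum>x\<in>X. if x = a then -1 else 0 :: int)"
        by (intro sum.cong) (auto simp: 2)
      then show ?thesis using 2 nsing finX by simp
    qed
  qed
  have "(\<Sum>i\<in>I. c i * (if \<exists>a. J i = {a} then 1 else -1)) =
        (\<Sum>i\<in>I. \<Sum>x\<in>X. c i * (of_bool (x \<in> J i) - of_bool (x + \<delta> \<in> J i)))"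
    by (intro sum.cong refl) (simp add: jump flip: sum_distrib_left)
  also have "\<dots> = (\<Sum>x\<in>X. (\<Sum>i\<in>I. if x \<in> J i then c i else 0) - (\<Sum>i\<in>I. if x + \<delta> \<in> J i then c i else 0))"
    by (subst sum.swap) (auto simp: sum_subtractf[symmetric] intro!: sum.cong)
  also have "\<dots> = 0"
    using zero \<open>finite I\<close> by (simp add: sum.If_cases Int_def)
  finally show ?thesis .
qed

definition rel_open_cell :: "'a::euclidean_space set \<Rightarrow> bool" where
  "rel_open_cell C \<longleftrightarrow> C \<noteq> {} \<and> convex C \<and> bounded C \<and> rel_interior C = C"

text \<open>A hyperplane through a point of a relatively open convex set either contains the set or cuts it in a
  relatively open convex set of one dimension less.\<close>

lemma rel_open_cell_slice:
  assumes C: "rel_open_cell C" and x: "x \<in> C" "a \<bullet> x = y"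
  shows "rel_open_cell (C \<inter> {x. a \<bullet> x = y})"
    and "aff_dim (C \<inter> {x. a \<bullet> x = y}) = 
      (if C \<subseteq> {x. a \<bullet> x = y} then aff_dim C else aff_dim C - 1)"
proof -
  let ?H = "{x. a \<bullet> x = y}"
  have H: "affine ?H" "convex ?H" by (simp_all add: affine_hyperplane affine_imp_convex)
  have relH: "rel_interior ?H = ?H" using H rel_interior_affine by blast
  have "rel_interior (C \<inter> ?H) = C \<inter> ?H"
    using convex_rel_interior_inter_two[of C ?H] C H relH x by (auto simp: rel_open_cell_def)
  then show "rel_open_cell (C \<inter> ?H)"
    using C H x by (auto simp: rel_open_cell_def convex_Int intro: bounded_subset)
  have "openin (top_of_set (affine hull C)) C"
    using C by (metis rel_interior_eq rel_open_cell_def)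
  then obtain V where "open V" "C = affine hull C \<inter> V"
    by (auto simp: openin_open)
  then have slice: "openin (top_of_set (affine hull C \<inter> ?H)) (C \<inter> ?H)"
    unfolding openin_open by blast
  have hull: "affine hull (affine hull C \<inter> ?H) = affine hull C \<inter> ?H"
    by (intro affine_hull_eq[THEN iffD2] affine_Int H) simp
  have "C \<inter> ?H \<noteq> {}" using x by blast
  then have "affine hull (C \<inter> ?H) = affine hull C \<inter> ?H"
    using affine_hull_openin[of "affine hull C \<inter> ?H" "C \<inter> ?H", unfolded hull] slice by blast
  then have "aff_dim (C \<inter> ?H) = aff_dim (affine hull C \<inter> ?H)"
    by (metis aff_dim_affine_hull)
  also have "\<dots> = (if affine hull C \<inter> ?H = {} then -1 else if affine hull C \<subseteq> ?H then aff_dim (affine hull C)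
      else aff_dim (affine hull C) - 1)"
    by (rule aff_dim_affine_Int_hyperplane) simp
  also have "\<dots> = (if C \<subseteq> ?H then aff_dim C else aff_dim C - 1)"
    using x H(1) hull_minimal[of C ?H affine] hull_subset[of C affine] by auto
  finally show "aff_dim (C \<inter> ?H) = \<dots>" .
qed

lemma open_bounded_convex_real:
  fixes S :: "real set"
  assumes "open S" "bounded S" "convex S" "S \<noteq> {}"
  shows "\<exists>u v. S = {u<..<v}"
proof -
  obtain M where M: "\<And>x. x \<in> S \<Longrightarrow> \<bar>x\<bar> \<le> M"
    using \<open>bounded S\<close> by (auto simp: bounded_iff)
  have no_ray: "\<not> {..<b} \<subseteq> S" "\<not> {b<..} \<subseteq> S" for b
    using M[of "min (b - 1) (- M - 1)"] M[of "max (b + 1) (M + 1)"] by force+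
  have int: "interior S = S" using \<open>open S\<close> by (rule interior_open)
  obtain a b where "S = {} \<or> S = UNIV \<or> S = {..<b} \<or> S = {..b} \<or> S = {a<..} \<or> S = {a..} \<or>
      S = {a<..<b} \<or> S = {a<..b} \<or> S = {a..<b} \<or> S = {a..b}"
    using is_real_interval[of S] \<open>convex S\<close> is_interval_convex_1 by blast
  then have "S = {a<..<b} \<or> S = {a<..b} \<or> S = {a..<b} \<or> S = {a..b}"
    using \<open>S \<noteq> {}\<close> no_ray[of a] no_ray[of b] by force
  then have "interior S = {a<..<b}" by auto
  then show ?thesis using int by auto
qed

lemma rel_open_cell_shadow:
  assumes C: "rel_open_cell C"
  shows "(\<exists>y. (\<bullet>) a ` C = {y}) \<or> (\<exists>u v. u < v \<and> (\<bullet>) a ` C = {u<..<v})"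
proof -
  let ?S = "(\<bullet>) a ` C"
  have lin: "linear ((\<bullet>) a)" by (simp add: bounded_linear.linear bounded_linear_inner_right)
  have S: "convex ?S" "?S \<noteq> {}" "bounded ?S" "rel_interior ?S = ?S"
    using C convex_linear_image[OF lin] bounded_linear_image[OF _ bounded_linear_inner_right]
      rel_interior_convex_linear_image[OF lin, of C]
    by (auto simp: rel_open_cell_def)
  show ?thesis
  proof (cases "\<exists>y. ?S = {y}")
    case False
    then have "aff_dim ?S \<noteq> 0" by (simp add: aff_dim_eq_0)
    moreover have "aff_dim ?S \<noteq> -1" "aff_dim ?S \<le> 1" "aff_dim ?S \<ge> -1"
      using S(2) aff_dim_le_DIM[of ?S] aff_dim_geq[of ?S] by (auto simp: aff_dim_empty)
    ultimately have "affine hull ?S = UNIV" using aff_dim_eq_full[of ?S] by simp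
    then have "open ?S" using rel_interior_interior[of ?S] S(4) by (metis open_interior)
    obtain u v where "?S = {u<..<v}"
      using open_bounded_convex_real[OF \<open>open ?S\<close> S(3,1,2)] by blast
    then show ?thesis using S(2) by (metis greaterThanLessThan_empty_iff not_le)
  qed auto
qed

text \<open>Induction on the dimension of the ambient space \<open>U\<close>.  For a non-constant linear functional, the induction
  hypothesis applies to the slices over each value \<open>y\<close>.  The dimension of the slice of \<open>C i\<close> is the same for
  all \<open>y\<close> in the image \<open>J i\<close> of \<open>C i\<close>, so that the slices give a relation between the indicators of
  the points and open intervals \<open>J i\<close>, to which the one-dimensional case applies.\<close>

lemma Euler_relation_aux:
  fixes C :: "'i \<Rightarrow> 'a::euclidean_space set" and c :: "'i \<Rightarrow> int"
  assumes "finite I" "\<And>i. i \<in> I \<Longrightarrow> rel_open_cell (C i)"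
    and "\<And>i. i \<in> I \<Longrightarrow> C i \<subseteq> U" "affine U" "aff_dim U \<le> int n"
    and "\<And>x. (\<Sum>i\<in>{i\<in>I. x \<in> C i}. c i) = 0"
  shows "(\<Sum>i\<in>I. c i * (-1) ^ nat (aff_dim (C i))) = 0"
  using assms
proof (induction n arbitrary: I C c U)
  case 0
  show ?case
  proof (cases "I = {}")
    case False
    then obtain i where "i \<in> I" by blast
    then obtain u where "u \<in> C i" using 0(2)[of i] by (auto simp: rel_open_cell_def)
    then have "u \<in> U" using 0 \<open>i \<in> I\<close> by auto
    then have "aff_dim U \<noteq> -1" "aff_dim U \<ge> -1" using aff_dim_empty[of U] aff_dim_geq[of U] by auto
    then have "aff_dim U = 0" using 0 by linarith
    then have "U = {u}" using \<open>u \<in> U\<close> aff_dim_eq_0[of U] by auto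
    then have Ci: "C i = {u}" if "i \<in> I" for i
      using 0(2,3)[OF that] by (auto simp: rel_open_cell_def)
    then have "{i \<in> I. u \<in> C i} = I" by auto
    then show ?thesis using 0(6)[of u] Ci by simp
  qed simp
next
  case (Suc n)
  show ?case
  proof (cases "\<exists>u\<in>U. \<exists>v\<in>U. u \<noteq> v")
    case False
    then have "aff_dim U \<le> 0" 
    proof (cases "U = {}")
      case False
      then obtain u where "U = {u}" using \<open>\<not> (\<exists>u\<in>U. \<exists>v\<in>U. u \<noteq> v)\<close> by blast
      then show ?thesis by simp
    qed simp
    then show ?thesis using Suc.IH[of I C U c] Suc.prems by simp
  next
    case True
    then obtain u v where uv: "u \<in> U" "v \<in> U" "u \<noteq> v" by blast
    define a where "a = v - u"
    define H where "H y = {x. a \<bullet> x = y}" for y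
    define J where "J i = (\<bullet>) a ` C i" for i
    \<comment> \<open>The dimension of the slices of \<open>C i\<close>, which drops unless \<open>C i\<close> lies in a single slice.\<close>
    define d where "d i = nat (if \<exists>y. J i = {y} then aff_dim (C i) else aff_dim (C i) - 1)" for i
    have sub: "C i \<subseteq> H y \<longleftrightarrow> J i = {y}" if "i \<in> I" for i y
      using Suc.prems(2)[OF that] by (auto simp: J_def H_def rel_open_cell_def)
    have J_sing: "(\<exists>y'. J i = {y'}) \<longleftrightarrow> J i = {y}" if "y \<in> J i" for i y using that by auto
    have dim_slice: "aff_dim (C i \<inter> H y) = (if \<exists>y. J i = {y} then aff_dim (C i) else aff_dim (C i) - 1)"
      and cell_slice: "rel_open_cell (C i \<inter> H y)" if iy: "i \<in> I" "y \<in> J i" for i y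
    proof -
      obtain x where x: "x \<in> C i" "a \<bullet> x = y" using iy by (auto simp: J_def)
      note s = rel_open_cell_slice[OF Suc.prems(2)[OF iy(1)] x, folded H_def]
      show "rel_open_cell (C i \<inter> H y)" by (rule s(1))
      show "aff_dim (C i \<inter> H y) = (if \<exists>y. J i = {y} then aff_dim (C i) else aff_dim (C i) - 1)"
        using s(2) sub[OF iy(1)] J_sing[OF iy(2)] by simp
    qed
    have "(\<Sum>i\<in>{i\<in>I. y \<in> J i}. c i * (-1) ^ d i) = 0" for y
    proof -
      have "(\<Sum>i\<in>{i\<in>I. y \<in> J i}. c i * (-1) ^ nat (aff_dim (C i \<inter> H y))) = 0"
      proof (rule Suc.IH[where U = "U \<inter> H y"])
        show "aff_dim (U \<inter> H y) \<le> int n"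
        proof -
          have "a \<bullet> (v - u) \<noteq> 0" using uv by (simp add: a_def)
          then have "\<not> (a \<bullet> u = y \<and> a \<bullet> v = y)" by (simp add: inner_diff_right)
          then have "\<not> U \<subseteq> H y" using uv by (auto simp: H_def)
          then show ?thesis
            using aff_dim_affine_Int_hyperplane[OF Suc.prems(4), of a y] Suc.prems(5) by (simp add: H_def)
        qed
        show "affine (U \<inter> H y)"
          using Suc.prems(4) by (simp add: H_def affine_Int affine_hyperplane)
        show "(\<Sum>i\<in>{i \<in> {i \<in> I. y \<in> J i}. x \<in> C i \<inter> H y}. c i) = 0" for x
        proof (cases "x \<in> H y")
          case True
          then have "{i \<in> {i \<in> I. y \<in> J i}. x \<in> C i \<inter> H y} = {i\<in>I. x \<in> C i}"
            by (auto simp: J_def H_def)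
          then show ?thesis using Suc.prems(6) by simp
        qed simp
      qed (use Suc.prems cell_slice in auto)
      moreover have "nat (aff_dim (C i \<inter> H y)) = d i" if "i \<in> I" "y \<in> J i" for i
        using dim_slice[OF that] by (simp add: d_def)
      ultimately show ?thesis by simp
    qed
    then have "(\<Sum>i\<in>I. c i * (-1) ^ d i * (if \<exists>a. J i = {a} then 1 else -1)) = 0"
      using rel_open_cell_shadow[OF Suc.prems(2), of _ a] interval_sum_eq_zero[OF Suc.prems(1), of J]
      by (simp add: J_def)
    moreover have "c i * (-1) ^ d i * (if \<exists>a. J i = {a} then 1 else -1) = c i * (-1) ^ nat (aff_dim (C i))"
      if i: "i \<in> I" for i
    proof (cases "\<exists>y. J i = {y}")
      case False
      obtain x where "x \<in> C i" using Suc.prems(2)[OF i] by (auto simp: rel_open_cell_def)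
      then have "aff_dim (C i \<inter> H (a \<bullet> x)) = aff_dim (C i) - 1" "C i \<inter> H (a \<bullet> x) \<noteq> {}"
        using dim_slice[OF i, of "a \<bullet> x"] False by (auto simp: J_def H_def)
      then have "aff_dim (C i) - 1 \<ge> 0"
        using aff_dim_empty[of "C i \<inter> H (a \<bullet> x)"] aff_dim_geq[of "C i \<inter> H (a \<bullet> x)"] by linarith
      then have "nat (aff_dim (C i)) = Suc (d i)" using False by (simp add: d_def)
      then show ?thesis using False by simp
    qed (simp add: d_def)
    ultimately show ?thesis by simp
  qed
qed

text \<open>The Euler characteristic with compact support is a valuation: a linear relation between the indicator
  functions of bounded relatively open convex sets persists when each indicator is replaced by
  \<open>(-1)\<close> to the dimension of its set.\<close>

theorem Euler_relation:
  fixes C :: "'i \<Rightarrow> 'a::euclidean_space set" and c :: "'i \<Rightarrow> int"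
  assumes "finite I" "\<And>i. i \<in> I \<Longrightarrow> rel_open_cell (C i)"
    and "\<And>x. (\<Sum>i\<in>{i\<in>I. x \<in> C i}. c i) = 0"
  shows "(\<Sum>i\<in>I. c i * (-1) ^ nat (aff_dim (C i))) = 0"
  using Euler_relation_aux[where U = UNIV and n = "DIM('a)"] assms by auto

section \<open>Tetrahedral complexes and their Euler characteristic\<close>

definition corners :: "(real^3) set \<Rightarrow> (real^3) set" where
  "corners t = {v. v extreme_point_of t}"

lemma corners_convex_hull:
  "\<not> affine_dependent D \<Longrightarrow> corners (convex hull D) = D"
  by (simp add: corners_def extreme_point_of_convex_hull_affine_independent)

lemma tetrahedron_corners:
  assumes "3 simplex t"
  shows "\<not> affine_dependent (corners t)" "card (corners t) = 4" "convex hull (corners t) = t"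
    "finite (corners t)"
proof -
  obtain C where C: "\<not> affine_dependent C" "int (card C) = 3 + 1" "t = convex hull C"
    using assms by (auto simp: simplex_def)
  then have "corners t = C" by (simp add: corners_convex_hull)
  then show "\<not> affine_dependent (corners t)" "card (corners t) = 4" "convex hull (corners t) = t"
    "finite (corners t)"
    using C aff_independent_finite by auto
qed

text \<open>Conformity in the form that the proofs use.  Simplices are represented by their finite sets of corners, so
  that counting faces of a tetrahedron is counting subsets, and the number of corners is one more than the
  dimension.\<close>

locale tetrahedral_complex =
  fixes T :: "(real^3) set set"
  assumes finite_T: "finite T"
    and tetrahedra: "t \<in> T \<Longrightarrow> 3 simplex t"
    and meet: "s \<in> T \<Longrightarrow> t \<in> T \<Longrightarrow> s \<inter> t face_of s"
begin

definition simplices :: "(real^3) set set" where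
  "simplices = {D. D \<noteq> {} \<and> (\<exists>t\<in>T. D \<subseteq> corners t)}"

definition simplices_of_card :: "nat \<Rightarrow> (real^3) set set" where
  "simplices_of_card k = {D \<in> simplices. card D = k}"

lemma simplicesD:
  assumes "D \<in> simplices"
  shows "D \<noteq> {}" "finite D" "\<not> affine_dependent D" "corners (convex hull D) = D"
    "aff_dim (convex hull D) = int (card D) - 1" "card D > 0" "card D \<le> 4"
proof -
  obtain t where t: "t \<in> T" "D \<subseteq> corners t" "D \<noteq> {}" using assms by (auto simp: simplices_def)
  note c = tetrahedron_corners[OF tetrahedra[OF t(1)]]
  show D: "D \<noteq> {}" "finite D" "\<not> affine_dependent D"
    using t(2,3) c(1,4) affine_independent_subset[of "corners t" D] finite_subset by blast+
  then show "corners (convex hull D) = D"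
    by (simp add: corners_convex_hull)
  show "aff_dim (convex hull D) = int (card D) - 1"
    using D aff_dim_affine_independent[of D] by (simp add: aff_dim_convex_hull)
  show "card D > 0" using D by (simp add: card_gt_0_iff)
  show "card D \<le> 4" using c t by (metis card_mono)
qed

lemma simplices_subset: "D \<in> simplices \<Longrightarrow> D' \<subseteq> D \<Longrightarrow> D' \<noteq> {} \<Longrightarrow> D' \<in> simplices"
  unfolding simplices_def by blast

lemma finite_simplices: "finite simplices"
proof (rule finite_subset)
  show "simplices \<subseteq> (\<Union>t\<in>T. Pow (corners t))" by (auto simp: simplices_def)
  show "finite (\<Union>t\<in>T. Pow (corners t))"
    using finite_T tetrahedron_corners(4)[OF tetrahedra] by auto
qed

lemma finite_simplices_of_card [simp]: "finite (simplices_of_card k)"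
  using finite_simplices by (simp add: simplices_of_card_def)

lemma inj_on_hull: "inj_on ((hull) convex) simplices"
  by (rule inj_on_inverseI[where g = corners]) (rule simplicesD(4))

lemma hull_face_iff:
  assumes "D \<in> simplices" "t \<in> T"
  shows "convex hull D face_of t \<longleftrightarrow> D \<subseteq> corners t"
proof -
  note c = tetrahedron_corners[OF tetrahedra[OF assms(2)]]
  show ?thesis
  proof
    assume "convex hull D face_of t"
    then have "convex hull D face_of convex hull (corners t)" by (simp add: c)
    then obtain C where C: "C \<subseteq> corners t" "convex hull D = convex hull C"
      using face_of_convex_hull_affine_independent[OF c(1)] by blast
    have "\<not> affine_dependent C" using C(1) c(1) affine_independent_subset by blast
    then have "C = corners (convex hull D)" by (simp add: C(2) corners_convex_hull)
    then show "D \<subseteq> corners t" using C(1) simplicesD(4)[OF assms(1)] by simp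
  next
    assume "D \<subseteq> corners t"
    then have "convex hull D face_of convex hull (corners t)"
      using face_of_convex_hull_affine_independent[OF c(1)] by blast
    then show "convex hull D face_of t" by (simp add: c)
  qed
qed

lemma face_eq_hull:
  assumes "t \<in> T" "f face_of t" "f \<noteq> {}"
  obtains D where "D \<in> simplices" "D \<subseteq> corners t" "f = convex hull D"
proof -
  note c = tetrahedron_corners[OF tetrahedra[OF assms(1)]]
  have "f face_of convex hull (corners t)" using assms by (simp add: c)
  then obtain D where "D \<subseteq> corners t" "f = convex hull D"
    using face_of_convex_hull_affine_independent[OF c(1)] by blast
  moreover then have "D \<in> simplices" using assms by (auto simp: simplices_def)
  ultimately show ?thesis using that by blast
qed

lemma rel_interior_hull_nonempty:
  "D \<in> simplices \<Longrightarrow> rel_interior (convex hull D) \<noteq> {}"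
  using simplicesD(1) by (simp add: rel_interior_eq_empty)

text \<open>A tetrahedron \<open>t\<close> that meets the relative interior of a simplex has it as a face: with \<open>s\<close> a tetrahedron
  of the simplex, \<open>s \<inter> t\<close> is a face of \<open>s\<close> that meets this relative interior, hence it contains the whole
  simplex.\<close>

lemma corners_if_meets:
  assumes D: "D \<in> simplices" and t: "t \<in> T" and x: "x \<in> rel_interior (convex hull D)" "x \<in> t"
  shows "D \<subseteq> corners t"
proof -
  obtain s where s: "s \<in> T" "D \<subseteq> corners s" using D by (auto simp: simplices_def)
  have f: "convex hull D face_of s" using hull_face_iff D s by simp
  have xs: "x \<in> s" using x(1) f rel_interior_subset face_of_imp_subset by blast
  have "convex hull D \<subseteq> s \<inter> t"
    by (rule subset_of_face_of[OF meet[OF s(1) t]]) (use f face_of_imp_subset x xs in auto)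
  then have "convex hull D face_of (s \<inter> t)" using f face_of_subset by blast
  also have "s \<inter> t face_of t" using meet[OF t s(1)] by (simp add: Int_commute)
  finally show ?thesis using hull_face_iff[OF D t] by simp
qed

text \<open>Together with the next lemma: the relative interiors of the simplices partition the mesh.\<close>

lemma open_simplices_disjoint:
  assumes "D \<in> simplices" "D' \<in> simplices"
    "x \<in> rel_interior (convex hull D)" "x \<in> rel_interior (convex hull D')"
  shows "D = D'"
proof -
  obtain t where t: "t \<in> T" "D' \<subseteq> corners t" using assms(2) by (auto simp: simplices_def)
  have f': "convex hull D' face_of t" using hull_face_iff assms(2) t by simp
  then have "x \<in> t" using assms(4) rel_interior_subset face_of_imp_subset by blast
  then have f: "convex hull D face_of t" using corners_if_meets[OF assms(1) t(1) assms(3)] hull_face_iff assms(1) t(1) by simp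
  have "convex hull D = convex hull D'" using face_of_eq[OF f f'] assms(3,4) by blast
  then show ?thesis using inj_on_hull assms(1,2) by (auto dest: inj_onD)
qed

lemma open_simplices_cover:
  assumes "x \<in> \<Union>T"
  shows "\<exists>D\<in>simplices. x \<in> rel_interior (convex hull D)"
proof -
  obtain t where t: "t \<in> T" "x \<in> t" using assms by blast
  note c = tetrahedron_corners[OF tetrahedra[OF t(1)]]
  have "x \<in> convex hull (corners t)" using t c by simp
  then obtain u where u: "\<forall>v\<in>corners t. 0 \<le> u v" "sum u (corners t) = 1" "(\<Sum>v\<in>corners t. u v *\<^sub>R v) = x"
    using convex_hull_finite[OF c(4)] by blast
  \<comment> \<open>The corners with nonzero barycentric coordinate span the open simplex around \<open>x\<close>.\<close>
  define D where "D = {v \<in> corners t. u v \<noteq> 0}"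
  have D: "D \<subseteq> corners t" by (auto simp: D_def)
  have "sum u D = 1" "(\<Sum>v\<in>D. u v *\<^sub>R v) = x"
    using u(2,3) by (auto simp: D_def intro!: sum.mono_neutral_cong_left[OF c(4), symmetric] trans[OF _ u(2)] trans[OF _ u(3)] sum.mono_neutral_cong_left[OF c(4)])
  moreover have "\<forall>v\<in>D. 0 < u v" using u(1) by (force simp: D_def)
  ultimately have "x \<in> rel_interior (convex hull D)"
    using explicit_subset_rel_interior_convex_hull_minimal[of D] D c(4) finite_subset by blast
  moreover have "D \<noteq> {}" using \<open>sum u D = 1\<close> by auto
  ultimately show ?thesis using D t(1) by (auto simp: simplices_def)
qed

lemma hull_subset_mesh:
  assumes "D \<in> simplices"
  shows "convex hull D \<subseteq> \<Union>T"
proof -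
  obtain t where "t \<in> T" "D \<subseteq> corners t" using assms by (auto simp: simplices_def)
  then have "convex hull D \<subseteq> t" using hull_face_iff[OF assms] face_of_imp_subset by blast
  then show ?thesis using \<open>t \<in> T\<close> by blast
qed

lemma card_hull_image: "card (simplices_of_card k) = card ((hull) convex ` simplices_of_card k)"
  by (rule card_image[symmetric]) (rule inj_on_subset[OF inj_on_hull], auto simp: simplices_of_card_def)

lemma faces_of_dim:
  "{f. \<exists>t\<in>T. f face_of t \<and> aff_dim f = int k} = (hull) convex ` simplices_of_card (Suc k)"
proof (intro equalityI subsetI)
  fix f assume "f \<in> {f. \<exists>t\<in>T. f face_of t \<and> aff_dim f = int k}"
  then obtain t where t: "t \<in> T" "f face_of t" "aff_dim f = int k" by blast
  then have "f \<noteq> {}" by auto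
  with t obtain D where D: "D \<in> simplices" "f = convex hull D" using face_eq_hull by metis
  then have "card D = Suc k" using simplicesD(5)[OF D(1)] t(3) by simp
  then show "f \<in> (hull) convex ` simplices_of_card (Suc k)" using D by (auto simp: simplices_of_card_def)
next
  fix f assume "f \<in> (hull) convex ` simplices_of_card (Suc k)"
  then obtain D where D: "D \<in> simplices" "card D = Suc k" "f = convex hull D"
    by (auto simp: simplices_of_card_def)
  then obtain t where "t \<in> T" "D \<subseteq> corners t" by (auto simp: simplices_def)
  then show "f \<in> {f. \<exists>t\<in>T. f face_of t \<and> aff_dim f = int k}"
    using D hull_face_iff simplicesD(5)[OF D(1)] by auto
qed

lemma mesh_edges_eq: "mesh_edges T = (hull) convex ` simplices_of_card 2"
  using faces_of_dim[of 1] by (simp add: mesh_edges_def edge_of_def numeral_2_eq_2)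

lemma aff_dim_tetrahedron: "t \<in> T \<Longrightarrow> aff_dim t = 3"
  by (rule aff_dim_simplex[OF tetrahedra])

lemma mesh_faces_eq: "mesh_faces T = (hull) convex ` simplices_of_card 3"
proof -
  have "mesh_faces T = {f. \<exists>t\<in>T. f face_of t \<and> aff_dim f = int 2}"
    using aff_dim_tetrahedron by (fastforce simp: mesh_faces_def facet_of_def)
  then show ?thesis using faces_of_dim[of 2] by (simp add: numeral_3_eq_3)
qed

lemma tetrahedra_eq: "T = (hull) convex ` simplices_of_card 4"
proof -
  have "T = {f. \<exists>t\<in>T. f face_of t \<and> aff_dim f = int 3}"
  proof (intro equalityI subsetI)
    fix t assume "t \<in> T"
    then show "t \<in> {f. \<exists>t\<in>T. f face_of t \<and> aff_dim f = int 3}"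
      using aff_dim_tetrahedron face_of_refl[OF convex_simplex[OF tetrahedra]] by fastforce
  next
    fix f assume "f \<in> {f. \<exists>t\<in>T. f face_of t \<and> aff_dim f = int 3}"
    then obtain t where t: "t \<in> T" "f face_of t" "aff_dim f = 3" by auto
    then show "f \<in> T"
      using face_of_aff_dim_lt[of t f] aff_dim_tetrahedron convex_simplex[OF tetrahedra] by force
  qed
  also have "\<dots> = (hull) convex ` simplices_of_card 4"
    using faces_of_dim[of 3] by (simp add: eval_nat_numeral)
  finally show ?thesis .
qed

lemma vertices_eq: "simplices_of_card 1 = (\<lambda>v. {v}) ` mesh_vertices T"
  by (auto simp: simplices_of_card_def simplices_def mesh_vertices_def corners_def card_1_singleton_iff)

lemma finite_vertices: "finite (mesh_vertices T)"
  by (rule finite_imageD[of "\<lambda>v. {v}"]) (auto simp: vertices_eq[symmetric])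

lemma card_vertices: "card (mesh_vertices T) = card (simplices_of_card 1)"
  unfolding vertices_eq by (rule card_image[symmetric]) simp

lemma card_tetrahedra: "card T = card (simplices_of_card 4)"
  by (subst tetrahedra_eq) (simp add: card_hull_image)

lemma simplex_vertices: "D \<in> simplices \<Longrightarrow> D \<subseteq> mesh_vertices T"
  by (auto simp: simplices_def mesh_vertices_def corners_def)

definition euler :: int where
  "euler = (\<Sum>D\<in>simplices. (-1) ^ (card D - 1))"

lemma euler_eq:
  "euler = int (card (simplices_of_card 1)) - int (card (simplices_of_card 2))
         + int (card (simplices_of_card 3)) - int (card (simplices_of_card 4))"
proof -
  have S: "simplices = simplices_of_card 1 \<union> simplices_of_card 2 \<union> simplices_of_card 3 \<union> simplices_of_card 4"
  proof -
    have "card D \<in> {1, 2, 3, 4}" if "D \<in> simplices" for D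
      using simplicesD(6,7)[OF that] by auto
    then show ?thesis by (auto simp: simplices_of_card_def)
  qed
  have [simp]: "(\<Sum>D\<in>simplices_of_card k. (-1 :: int) ^ (card D - 1)) = (-1) ^ (k - 1) * int (card (simplices_of_card k))" for k
    by (simp add: simplices_of_card_def)
  show ?thesis
    unfolding euler_def S
    by (subst sum.union_disjoint, simp, simp, force simp: simplices_of_card_def)+ (simp del: One_nat_def)
qed

lemma card_open_simplices_at: "card {D \<in> simplices. x \<in> rel_interior (convex hull D)} = of_bool (x \<in> \<Union>T)"
proof (cases "x \<in> \<Union>T")
  case True
  then obtain D where D: "D \<in> simplices" "x \<in> rel_interior (convex hull D)"
    using open_simplices_cover by blast
  then have "{D \<in> simplices. x \<in> rel_interior (convex hull D)} = {D}"
    using open_simplices_disjoint by blast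
  then show ?thesis using True by simp
next
  case False
  then have "{D \<in> simplices. x \<in> rel_interior (convex hull D)} = {}"
    using hull_subset_mesh rel_interior_subset by blast
  then show ?thesis using False by (simp only: card.empty) simp
qed

lemma rel_open_cell_simplex:
  assumes "D \<in> simplices"
  shows "rel_open_cell (rel_interior (convex hull D))" 
    "nat (aff_dim (rel_interior (convex hull D))) = card D - 1"
proof -
  have c: "convex (convex hull D)" by simp
  have "bounded (convex hull D)" using simplicesD(2)[OF assms] by (simp add: finite_imp_bounded_convex_hull)
  then show "rel_open_cell (rel_interior (convex hull D))"
    unfolding rel_open_cell_def
    using rel_interior_hull_nonempty[OF assms] convex_rel_interior[OF c] rel_interior_rel_interior[OF c]
      bounded_subset[OF _ rel_interior_subset] by blast
  show "nat (aff_dim (rel_interior (convex hull D))) = card D - 1"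
    using rel_interior_aff_dim[OF c] simplicesD(5)[OF assms] by simp
qed

end

text \<open>Both partitions into open simplices have the same indicator function as their sum, so the difference is a
  linear relation between indicators of open cells.\<close>

lemma euler_invariant:
  assumes "tetrahedral_complex T" "tetrahedral_complex T'" "\<Union>T = \<Union>T'"
  shows "tetrahedral_complex.euler T = tetrahedral_complex.euler T'"
proof -
  interpret M: tetrahedral_complex T by fact
  interpret M': tetrahedral_complex T' by fact
  define C :: "(real^3) set + (real^3) set \<Rightarrow> (real^3) set"
    where "C = case_sum (\<lambda>D. rel_interior (convex hull D)) (\<lambda>D. rel_interior (convex hull D))"
  define c :: "(real^3) set + (real^3) set \<Rightarrow> int" where "c = case_sum (\<lambda>_. 1) (\<lambda>_. -1)"
  let ?I = "M.simplices <+> M'.simplices"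
  have "(\<Sum>i\<in>?I. c i * (-1) ^ nat (aff_dim (C i))) = 0"
  proof (rule Euler_relation)
    show "finite ?I" using M.finite_simplices M'.finite_simplices by simp
    show "rel_open_cell (C i)" if "i \<in> ?I" for i
      using that M.rel_open_cell_simplex M'.rel_open_cell_simplex by (auto simp: C_def)
    show "(\<Sum>i\<in>{i \<in> ?I. x \<in> C i}. c i) = 0" for x
    proof -
      have "{i \<in> ?I. x \<in> C i} = {D \<in> M.simplices. x \<in> rel_interior (convex hull D)} <+>
          {D \<in> M'.simplices. x \<in> rel_interior (convex hull D)}"
        by (auto simp: C_def)
      then show ?thesis
        using M.finite_simplices M'.finite_simplices M.card_open_simplices_at M'.card_open_simplices_at assms(3)
        by (simp add: sum.Plus c_def)
    qed
  qed
  then show ?thesis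
    using M.finite_simplices M'.finite_simplices
    by (simp add: sum.Plus c_def C_def M.rel_open_cell_simplex M'.rel_open_cell_simplex
        M.euler_def M'.euler_def sum_negf)
qed

section \<open>The number of faces is at most twice the number of edges\<close>

context tetrahedral_complex
begin

lemma sum_card_containing:
  "(\<Sum>v\<in>mesh_vertices T. card {D \<in> simplices_of_card k. v \<in> D}) = k * card (simplices_of_card k)"
proof -
  have "(\<Sum>v\<in>mesh_vertices T. card {D \<in> simplices_of_card k. v \<in> D}) = (\<Sum>D\<in>simplices_of_card k. k)"
  proof (rule sum_multicount_gen)
    show "\<forall>D\<in>simplices_of_card k. card {v \<in> mesh_vertices T. v \<in> D} = k"
    proof
      fix D assume D: "D \<in> simplices_of_card k"
      then have "{v \<in> mesh_vertices T. v \<in> D} = D"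
        using simplex_vertices[of D] by (auto simp: simplices_of_card_def)
      then show "card {v \<in> mesh_vertices T. v \<in> D} = k"
        using D by (simp add: simplices_of_card_def)
    qed
  qed (simp_all add: finite_vertices)
  then show ?thesis by simp
qed

definition neighbours :: "real^3 \<Rightarrow> (real^3) set" where
  "neighbours v = {w. w \<noteq> v \<and> {v, w} \<in> simplices}"

lemma finite_neighbours: "finite (neighbours v)"
  by (rule finite_subset[OF _ finite_vertices]) (use simplex_vertices in \<open>auto simp: neighbours_def\<close>)

lemma card_neighbours: "card (neighbours v) = card {D \<in> simplices_of_card 2. v \<in> D}"
proof -
  have "{D \<in> simplices_of_card 2. v \<in> D} = (\<lambda>w. {v, w}) ` neighbours v"
    by (auto simp: simplices_of_card_def neighbours_def card_2_iff doubleton_eq_iff insert_commute)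
  moreover have "inj_on (\<lambda>w. {v, w}) (neighbours v)"
    by (auto simp: inj_on_def doubleton_eq_iff)
  ultimately show ?thesis by (simp add: card_image)
qed

definition tetrahedra_at :: "(real^3) set \<Rightarrow> (real^3) set set" where
  "tetrahedra_at D = {t \<in> T. D \<subseteq> corners t}"

lemma finite_tetrahedra_at [simp]: "finite (tetrahedra_at D)"
  using finite_T by (simp add: tetrahedra_at_def)

lemma sum_tetrahedra_at: "(\<Sum>D\<in>simplices_of_card 3. card (tetrahedra_at D)) = 4 * card T"
proof -
  have "(\<Sum>D\<in>simplices_of_card 3. card {t \<in> T. D \<subseteq> corners t}) = (\<Sum>t\<in>T. 4)"
  proof (rule sum_multicount_gen)
    show "\<forall>t\<in>T. card {D \<in> simplices_of_card 3. D \<subseteq> corners t} = 4"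
    proof
      fix t assume t: "t \<in> T"
      note c = tetrahedron_corners[OF tetrahedra[OF t]]
      have "{D \<in> simplices_of_card 3. D \<subseteq> corners t} = {D. D \<subseteq> corners t \<and> card D = 3}"
        using t by (auto simp: simplices_of_card_def simplices_def)
      then show "card {D \<in> simplices_of_card 3. D \<subseteq> corners t} = 4"
        using n_subsets[OF c(4), of 3] c(2) by (simp add: eval_nat_numeral)
    qed
  qed (simp_all add: finite_T)
  then show ?thesis by (simp add: tetrahedra_at_def)
qed

lemma facet_iff:
  assumes "D \<in> simplices_of_card 3" "t \<in> T"
  shows "convex hull D facet_of t \<longleftrightarrow> t \<in> tetrahedra_at D"
  using assms hull_face_iff[of D t] simplicesD(1,5)[of D] aff_dim_tetrahedron[of t]
  by (auto simp: facet_of_def tetrahedra_at_def simplices_of_card_def)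

lemma facet_eq_hull:
  assumes "t \<in> T" "f facet_of t"
  obtains D where "D \<in> simplices_of_card 3" "t \<in> tetrahedra_at D" "f = convex hull D"
proof -
  obtain D where D: "D \<in> simplices" "D \<subseteq> corners t" "f = convex hull D"
    using face_eq_hull[OF assms(1)] assms(2) unfolding facet_of_def by metis
  moreover have "aff_dim f = 2" using assms aff_dim_tetrahedron by (simp add: facet_of_def)
  ultimately have "D \<in> simplices_of_card 3"
    using simplicesD(5)[of D] by (simp add: simplices_of_card_def)
  then show ?thesis using that D assms(1) by (simp add: tetrahedra_at_def)
qed

definition boundary_faces :: "(real^3) set set" where
  "boundary_faces = {D \<in> simplices_of_card 3. card (tetrahedra_at D) = 1}"

text \<open>Close to its corner \<open>v\<close>, a simplex looks like the cone that the edges at \<open>v\<close> span.\<close>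

lemma germ_in_rel_interior:
  assumes D: "D \<in> simplices" "v \<in> D" "D - {v} \<noteq> {}"
    and s: "\<And>w. w \<in> D - {v} \<Longrightarrow> s w > 0" and \<epsilon>: "\<epsilon> > 0" "\<epsilon> * sum s (D - {v}) < 1"
  shows "v + \<epsilon> *\<^sub>R (\<Sum>w\<in>D - {v}. s w *\<^sub>R (w - v)) \<in> rel_interior (convex hull D)"
proof -
  let ?W = "D - {v}"
  define u where "u w = (if w = v then 1 - \<epsilon> * sum s ?W else \<epsilon> * s w)" for w
  have fin: "finite D" using simplicesD(2) D by blast
  have "\<forall>w\<in>D. 0 < u w" using s \<epsilon> by (auto simp: u_def)
  moreover have "sum u D = 1"
    using fin D(2) by (simp add: sum.remove[of D v] u_def sum_distrib_left)
  moreover have "(\<Sum>w\<in>D. u w *\<^sub>R w) = v + \<epsilon> *\<^sub>R (\<Sum>w\<in>?W. s w *\<^sub>R (w - v))"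
  proof -
    have "(\<Sum>w\<in>D. u w *\<^sub>R w) = (1 - \<epsilon> * sum s ?W) *\<^sub>R v + (\<Sum>w\<in>?W. (\<epsilon> * s w) *\<^sub>R w)"
      using fin D(2) by (simp add: sum.remove[of D v] u_def)
    also have "\<dots> = v + \<epsilon> *\<^sub>R (\<Sum>w\<in>?W. s w *\<^sub>R (w - v))"
      by (simp add: scaleR_diff_right sum_subtractf scaleR_diff_left scaleR_sum_right
          flip: scaleR_left.sum)
    finally show ?thesis .
  qed
  ultimately show ?thesis
    using explicit_subset_rel_interior_convex_hull_minimal[OF fin] by blast
qed

text \<open>Hence the open cones that distinct simplices span at a common corner are disjoint: a common direction,
  scaled down by \<open>1 / M\<close>, would lead into both open simplices.\<close>

lemma germs_disjoint:
  assumes "D \<in> simplices" "v \<in> D" "D - {v} \<noteq> {}" "\<And>w. w \<in> D - {v} \<Longrightarrow> s w > 0"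
    and "D' \<in> simplices" "v \<in> D'" "D' - {v} \<noteq> {}" "\<And>w. w \<in> D' - {v} \<Longrightarrow> s' w > 0"
    and eq: "(\<Sum>w\<in>D - {v}. s w *\<^sub>R (w - v)) = (\<Sum>w\<in>D' - {v}. s' w *\<^sub>R (w - v))"
  shows "D = D'"
proof -
  define M where "M = 1 + sum s (D - {v}) + sum s' (D' - {v})"
  have nn: "sum s (D - {v}) \<ge> 0" "sum s' (D' - {v}) \<ge> 0"
    by (rule sum_nonneg, rule less_imp_le, erule assms(4,8))+
  then have M: "1 / M > 0" "1 / M * sum s (D - {v}) < 1" "1 / M * sum s' (D' - {v}) < 1"
    by (auto simp: M_def divide_simps)
  have "v + (1 / M) *\<^sub>R (\<Sum>w\<in>D - {v}. s w *\<^sub>R (w - v)) \<in> rel_interior (convex hull D)"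
    by (rule germ_in_rel_interior[OF assms(1-4) M(1,2)])
  moreover have "v + (1 / M) *\<^sub>R (\<Sum>w\<in>D' - {v}. s' w *\<^sub>R (w - v)) \<in> rel_interior (convex hull D')"
    by (rule germ_in_rel_interior[OF assms(5-8) M(1,3)])
  ultimately show ?thesis
    unfolding eq by (rule open_simplices_disjoint[OF assms(1,5)])
qed

lemma edge_germs:
  assumes "p \<in> neighbours v" "q \<in> neighbours v" "s > 0" "p - v = s *\<^sub>R (q - v)"
  shows "p = q"
proof -
  have "{v, p} = {v, q}"
    using assms by (intro germs_disjoint[of _ v "\<lambda>_. 1" _ "\<lambda>_. s"]) (auto simp: neighbours_def insert_Diff_if)
  then show ?thesis using assms by (auto simp: doubleton_eq_iff neighbours_def)
qed

lemma edge_face_germs: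
  assumes "{v, l, r} \<in> simplices_of_card 3" "w \<in> neighbours v" "s > 0" "t > 0"
  shows "w - v \<noteq> s *\<^sub>R (l - v) + t *\<^sub>R (r - v)"
proof
  assume eq: "w - v = s *\<^sub>R (l - v) + t *\<^sub>R (r - v)"
  have ne: "v \<noteq> l" "v \<noteq> r" "l \<noteq> r" and c3: "card {v, l, r} = 3"
    using assms(1) by (auto simp: simplices_of_card_def card_insert_if split: if_splits)
  have "{v, w} = {v, l, r}"
    using assms ne eq by (intro germs_disjoint[of _ v "\<lambda>_. 1" _ "\<lambda>x. if x = l then s else t"])
      (auto simp: neighbours_def insert_Diff_if simplices_of_card_def)
  then have "card {v, w} = 3" using c3 by metis
  then show False by (simp add: card_insert_if split: if_splits)
qed

lemma face_germs:
  assumes "{v, l, r} \<in> simplices_of_card 3" "{v, l', r'} \<in> simplices_of_card 3"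
    "s > 0" "t > 0" "s' > 0" "t' > 0"
    "s *\<^sub>R (l - v) + t *\<^sub>R (r - v) = s' *\<^sub>R (l' - v) + t' *\<^sub>R (r' - v)"
  shows "{l, r} = {l', r'}"
proof -
  have ne: "v \<noteq> l" "v \<noteq> r" "l \<noteq> r" "v \<noteq> l'" "v \<noteq> r'" "l' \<noteq> r'"
    using assms(1,2) by (auto simp: simplices_of_card_def card_insert_if split: if_splits)
  have "{v, l, r} = {v, l', r'}"
    using assms ne by (intro germs_disjoint[of _ v "\<lambda>x. if x = l then s else t" _ "\<lambda>x. if x = l' then s' else t'"])
      (auto simp: insert_Diff_if simplices_of_card_def)
  then have "{v, l, r} - {v} = {v, l', r'} - {v}" by simp
  then show ?thesis using ne by (simp add: insert_Diff_if)
qed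

end

text \<open>The projection to a plane along the vector \<open>(c, c\<^sup>2, 1)\<close>.  Together with the third coordinate it is an
  isomorphism.  The directions run through a parabola, which meets every plane through the origin in at most two
  points, so almost all \<open>c\<close> are generic for a finite set of vectors.\<close>

definition shear :: "real \<Rightarrow> real^3 \<Rightarrow> real \<times> real" where
  "shear c p = (p $ 1 - c * p $ 3, p $ 2 - c^2 * p $ 3)"

lemma shear_linear [simp]:
  "shear c (p + q) = shear c p + shear c q" "shear c (s *\<^sub>R p) = s *\<^sub>R shear c p"
  by (simp_all add: shear_def algebra_simps)

lemma shear_height_inject:
  assumes "shear c p = shear c q" "p $ 3 = q $ 3"
  shows "p = q"
  using assms by (auto simp: shear_def vec_eq_iff forall_3)

lemma cross2_shear:
  "cross2 (shear c p) (shear c q) = cross3 p q $ 3 + c * cross3 p q $ 1 + c^2 * cross3 p q $ 2"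
  by (simp add: cross2_def shear_def cross3_def algebra_simps power2_eq_square)

lemma generic_shear:
  assumes "finite Q"
  shows "\<exists>c. \<forall>p\<in>Q. \<forall>q\<in>Q. cross3 p q \<noteq> 0 \<longrightarrow> cross2 (shear c p) (shear c q) \<noteq> 0"
proof -
  define N where "N = {cross3 p q | p q. p \<in> Q \<and> q \<in> Q} - {0}"
  have "N \<subseteq> (\<lambda>(p, q). cross3 p q) ` (Q \<times> Q)" by (auto simp: N_def)
  then have finN: "finite N" using assms finite_subset by blast
  have "finite (\<Union>n\<in>N. {c. poly [:n $ 3, n $ 1, n $ 2:] c = 0})"
  proof (intro finite_UN_I[OF finN] poly_roots_finite)
    fix n assume "n \<in> N"
    then have "n \<noteq> 0" by (simp add: N_def)
    then show "[:n $ 3, n $ 1, n $ 2:] \<noteq> 0" by (auto simp: vec_eq_iff forall_3)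
  qed
  then obtain c where c: "c \<notin> (\<Union>n\<in>N. {c. poly [:n $ 3, n $ 1, n $ 2:] c = 0})"
    using ex_new_if_finite[OF infinite_UNIV_char_0] by blast
  show ?thesis
  proof (intro exI ballI impI)
    fix p q assume "p \<in> Q" "q \<in> Q" "cross3 p q \<noteq> 0"
    then have "cross3 p q \<in> N" by (auto simp: N_def)
    then have "poly [:cross3 p q $ 3, cross3 p q $ 1, cross3 p q $ 2:] c \<noteq> 0" using c by blast
    then show "cross2 (shear c p) (shear c q) \<noteq> 0" by (simp add: cross2_shear algebra_simps power2_eq_square)
  qed
qed

lemma exists_cross_nonzero:
  assumes "q \<noteq> 0" shows "\<exists>i. cross3 q (axis i 1) \<noteq> 0"
proof -
  from assms obtain i where "q $ i \<noteq> 0" by (auto simp: vec_eq_iff)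
  then consider "q $ 1 \<noteq> 0" | "q $ 2 \<noteq> 0" | "q $ 3 \<noteq> 0" using exhaust_3[of i] by auto
  then show ?thesis
  proof cases
    case 1 then show ?thesis by (intro exI[of _ 2]) (auto simp: cross3_def vec_eq_iff forall_3 axis_def)
  next
    case 2 then show ?thesis by (intro exI[of _ 3]) (auto simp: cross3_def vec_eq_iff forall_3 axis_def)
  next
    case 3 then show ?thesis by (intro exI[of _ 1]) (auto simp: cross3_def vec_eq_iff forall_3 axis_def)
  qed
qed

context tetrahedral_complex
begin

text \<open>The edges and faces at \<open>v\<close> form an arc system for a generic shear.\<close>

theorem card_faces_at_vertex_le:
  "card {D \<in> simplices_of_card 3. v \<in> D} \<le> 3 * card (neighbours v)"
proof -
  define Q where "Q = (\<lambda>w. w - v) ` neighbours v"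
  \<comment> \<open>The axes are added since a vector has a nonzero shear if its shear is independent of another one.\<close>
  obtain c where "\<forall>p\<in>Q \<union> range (\<lambda>i. axis i 1). \<forall>q\<in>Q \<union> range (\<lambda>i. axis i 1).
      cross3 p q \<noteq> 0 \<longrightarrow> cross2 (shear c p) (shear c q) \<noteq> 0"
    using generic_shear[of "Q \<union> range (\<lambda>i. axis i 1)"] finite_neighbours by (auto simp: Q_def)
  then have c: "cross2 (shear c p) (shear c q) \<noteq> 0"
    if "p \<in> Q \<union> range (\<lambda>i. axis i 1)" "q \<in> Q \<union> range (\<lambda>i. axis i 1)" "cross3 p q \<noteq> 0" for p q
    using that by blast
  define sh where "sh w = shear c (w - v)" for w
  define h where "h w = (w - v) $ 3" for w
  have sh_nz: "sh w \<noteq> 0" if w: "w \<in> neighbours v" for w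
  proof -
    have "w - v \<noteq> 0" "w - v \<in> Q" using w by (auto simp: neighbours_def Q_def)
    moreover then obtain i where "cross3 (w - v) (axis i 1) \<noteq> 0" using exists_cross_nonzero by blast
    ultimately have "cross2 (sh w) (shear c (axis i 1)) \<noteq> 0" unfolding sh_def by (intro c) auto
    then show ?thesis by (auto simp: cross2_def)
  qed
  define A where "A = {(l, r). {v, l, r} \<in> simplices_of_card 3 \<and> cross2 (sh l) (sh r) > 0}"
  have face_nb: "l \<in> neighbours v" "r \<in> neighbours v" "l \<noteq> r" if "{v, l, r} \<in> simplices_of_card 3" for l r
  proof -
    have "v \<noteq> l" "v \<noteq> r" "l \<noteq> r"
      using that by (auto simp: simplices_of_card_def card_insert_if split: if_splits)
    then show "l \<in> neighbours v" "r \<in> neighbours v" "l \<noteq> r"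
      using that simplices_subset[of "{v, l, r}"] by (auto simp: neighbours_def simplices_of_card_def)
  qed
  have rebuild: "p - v = s *\<^sub>R (q - v) + t *\<^sub>R (r - v)"
    if "sh p = s *\<^sub>R sh q + t *\<^sub>R sh r" "h p = s * h q + t * h r" for p q r s t
    using that by (intro shear_height_inject[of c]) (simp_all add: sh_def h_def)
  interpret arc_system "neighbours v" A sh h
  proof
    show "finite (neighbours v)" by (rule finite_neighbours)
    show "A \<subseteq> neighbours v \<times> neighbours v" using face_nb by (auto simp: A_def)
    show "cross2 (sh l) (sh r) > 0" if "(l, r) \<in> A" for l r using that by (simp add: A_def)
    show "p = q" if pq: "p \<in> neighbours v" "q \<in> neighbours v" "s > 0" "sh p = s *\<^sub>R sh q" for p q s
    proof -
      have "cross2 (sh p) (sh q) = 0" by (simp add: pq(4))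
      then have "cross3 (p - v) (q - v) = 0"
        using c[of "p - v" "q - v"] pq by (auto simp: sh_def Q_def)
      then have "collinear {0, p - v, q - v}" by (simp add: cross_eq_0)
      moreover have "p - v \<noteq> 0" "q - v \<noteq> 0" using pq by (auto simp: neighbours_def)
      ultimately obtain k where k: "q - v = k *\<^sub>R (p - v)" by (auto simp: collinear_lemma)
      then have "sh p = (s * k) *\<^sub>R sh p" using pq(4) by (simp add: sh_def)
      then have "s * k = 1" using sh_nz[OF pq(1)] by (metis scaleR_cancel_right scaleR_one)
      then have "k > 0" using pq(3) by (metis zero_less_mult_pos zero_less_one)
      then show ?thesis using edge_germs[OF pq(2,1) _ k] by simp
    qed
    show "h w \<noteq> s * h l + t * h r"
      if "(l, r) \<in> A" "w \<in> neighbours v" "s > 0" "t > 0" "sh w = s *\<^sub>R sh l + t *\<^sub>R sh r" for l r w s t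
      using edge_face_germs[of v l r w s t] rebuild[of w s l t r] that by (auto simp: A_def)
    show "(l, r) = (l', r')"
      if a: "(l, r) \<in> A" "(l', r') \<in> A" and pos: "s > 0" "t > 0" "s' > 0" "t' > 0"
        and eq: "s *\<^sub>R sh l + t *\<^sub>R sh r = s' *\<^sub>R sh l' + t' *\<^sub>R sh r'"
          "s * h l + t * h r = s' * h l' + t' * h r'" for l r l' r' s t s' t'
    proof -
      have "s *\<^sub>R (l - v) + t *\<^sub>R (r - v) = s' *\<^sub>R (l' - v) + t' *\<^sub>R (r' - v)"
        using eq by (intro shear_height_inject[of c]) (simp_all add: sh_def h_def)
      then have "{l, r} = {l', r'}" using face_germs[of v l r l' r' s t s' t'] a pos by (simp add: A_def)
      moreover have "\<not> (l = r' \<and> r = l')"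
        using a cross2_swap[of "sh l" "sh r"] by (auto simp: A_def)
      ultimately show ?thesis by (auto simp: doubleton_eq_iff)
    qed
  qed
  have "{D \<in> simplices_of_card 3. v \<in> D} \<subseteq> (\<lambda>(l, r). {v, l, r}) ` A"
  proof
    fix D assume "D \<in> {D \<in> simplices_of_card 3. v \<in> D}"
    then have D: "D \<in> simplices_of_card 3" "v \<in> D" "card D = 3" by (auto simp: simplices_of_card_def)
    then have "card (D - {v}) = 2" by simp
    then obtain a b where "D - {v} = {a, b}" by (auto simp: card_2_iff)
    then have Deq: "D = {v, a, b}" using D(2) by blast
    have "\<not> affine_dependent {v, a, b}" using D simplicesD(3) Deq by (auto simp: simplices_of_card_def)
    moreover have "v \<noteq> a" "v \<noteq> b" "a \<noteq> b"
      using D(3) by (auto simp: Deq card_insert_if split: if_splits)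
    ultimately have "\<not> collinear {v, a, b}" by (simp add: collinear_3_eq_affine_dependent)
    then have "\<not> collinear {0, a - v, b - v}"
      using collinear_3[of a v b] by (simp add: insert_commute)
    then have "cross3 (a - v) (b - v) \<noteq> 0" by (simp add: cross_eq_0)
    then have "cross2 (sh a) (sh b) \<noteq> 0"
      unfolding sh_def using face_nb[of a b] D(1) Deq by (intro c) (auto simp: Q_def)
    then have "(a, b) \<in> A \<or> (b, a) \<in> A"
      using D(1) Deq cross2_swap[of "sh a" "sh b"] by (auto simp: A_def insert_commute)
    then show "D \<in> (\<lambda>(l, r). {v, l, r}) ` A"
      using Deq by (auto simp: insert_commute image_iff)
  qed
  then have "card {D \<in> simplices_of_card 3. v \<in> D} \<le> card A"
    by (rule surj_card_le[OF finite_A])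
  then show ?thesis using card_arcs_le by simp
qed

text \<open>Sum the local bound over all vertices: a face is counted at three vertices, an edge at two.\<close>

theorem card_faces_le: "card (simplices_of_card 3) \<le> 2 * card (simplices_of_card 2)"
proof -
  have "3 * card (simplices_of_card 3) = (\<Sum>v\<in>mesh_vertices T. card {D \<in> simplices_of_card 3. v \<in> D})"
    by (simp add: sum_card_containing)
  also have "\<dots> \<le> (\<Sum>v\<in>mesh_vertices T. 3 * card (neighbours v))"
    by (intro sum_mono card_faces_at_vertex_le)
  also have "\<dots> = 3 * (\<Sum>v\<in>mesh_vertices T. card {D \<in> simplices_of_card 2. v \<in> D})"
    by (simp add: card_neighbours sum_distrib_left)
  also have "\<dots> = 6 * card (simplices_of_card 2)" by (simp add: sum_card_containing)
  finally show ?thesis by simp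
qed

lemma average_degree_eq:
  "average_degree T = 2 * real (card (simplices_of_card 2)) / real (card (simplices_of_card 1))"
proof -
  have "(\<Sum>v\<in>mesh_vertices T. vertex_degree T v) = (\<Sum>v\<in>mesh_vertices T. card {D \<in> simplices_of_card 2. v \<in> D})"
  proof (rule sum.cong[OF refl])
    fix v
    have "{e \<in> mesh_edges T. v extreme_point_of e} = (hull) convex ` {D \<in> simplices_of_card 2. v \<in> D}"
      using simplicesD(4) by (force simp: mesh_edges_eq simplices_of_card_def corners_def)
    then show "vertex_degree T v = card {D \<in> simplices_of_card 2. v \<in> D}"
      unfolding vertex_degree_def
      by (simp add: card_image inj_on_subset[OF inj_on_hull] simplices_of_card_def Collect_mono_iff)
  qed
  also have "\<dots> = 2 * card (simplices_of_card 2)" by (rule sum_card_containing)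
  finally have "(\<Sum>v\<in>mesh_vertices T. real (vertex_degree T v)) = real (2 * card (simplices_of_card 2))"
    by (metis of_nat_sum)
  then show ?thesis by (simp add: average_degree_def card_vertices)
qed

end

section \<open>Counting the cells of a refined mesh\<close>

context tetrahedral_complex
begin

lemma small_tetrahedron_subset_unique:
  assumes "s \<in> T" "t \<in> T" "t' \<subseteq> s" "t' \<subseteq> t" "aff_dim t' = 3"
  shows "s = t"
proof -
  have "a \<inter> b = a" if "a \<in> T" "b \<in> T" "t' \<subseteq> a" "t' \<subseteq> b" for a b
  proof (rule ccontr)
    assume "a \<inter> b \<noteq> a"
    then have "aff_dim (a \<inter> b) < 3"
      using face_of_aff_dim_lt[OF convex_simplex[OF tetrahedra[OF that(1)]] meet[OF that(1,2)]]
        aff_dim_tetrahedron[OF that(1)] by simp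
    then show False using aff_dim_subset[of t' "a \<inter> b"] assms(5) that by simp
  qed
  from this[OF assms(1,2,3,4)] this[OF assms(2,1,4,3)] show ?thesis by blast
qed

text \<open>Near a point of an open face that lies in a single tetrahedron, the mesh coincides with that
  tetrahedron.\<close>

lemma boundary_face_not_interior:
  assumes D: "D \<in> boundary_faces" and x: "x \<in> rel_interior (convex hull D)"
  shows "x \<notin> interior (\<Union>T)"
proof
  assume xi: "x \<in> interior (\<Union>T)"
  have Ds: "D \<in> simplices" "card D = 3" using D by (auto simp: boundary_faces_def simplices_of_card_def)
  obtain t where t: "tetrahedra_at D = {t}"
    using D by (auto simp: boundary_faces_def card_1_singleton_iff)
  then have tT: "t \<in> T" "D \<subseteq> corners t" by (auto simp: tetrahedra_at_def)
  define U where "U = \<Union>(T - {t})"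
  have "x \<notin> U"
  proof
    assume "x \<in> U"
    then obtain s where s: "s \<in> T" "s \<noteq> t" "x \<in> s" by (auto simp: U_def)
    then have "s \<in> tetrahedra_at D"
      using corners_if_meets[OF Ds(1) s(1) x s(3)] by (simp add: tetrahedra_at_def)
    then show False using t s(2) by simp
  qed
  moreover have "closed U"
    unfolding U_def using finite_T closed_simplex[OF tetrahedra] by (intro closed_Union) auto
  ultimately have "open (interior (\<Union>T) - U)" "x \<in> interior (\<Union>T) - U" using xi by (auto intro: open_Diff)
  moreover have "interior (\<Union>T) - U \<subseteq> t" using interior_subset[of "\<Union>T"] by (auto simp: U_def)
  ultimately have "x \<in> interior t" using interior_maximal by blast
  moreover have "convex hull D face_of t" using hull_face_iff Ds tT by simp
  moreover have "convex hull D \<noteq> t"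
    using simplicesD(5)[OF Ds(1)] Ds(2) aff_dim_tetrahedron[OF tT(1)] by auto
  ultimately show False
    using face_of_disjoint_interior x rel_interior_subset by blast
qed

definition pseudomanifold :: bool where
  "pseudomanifold \<longleftrightarrow> (\<forall>D\<in>simplices_of_card 3. card (tetrahedra_at D) \<in> {1, 2})"

lemma double_count_faces:
  assumes pseudomanifold
  shows "4 * card T + card boundary_faces = 2 * card (simplices_of_card 3)"
proof -
  have "(\<Sum>D\<in>simplices_of_card 3. card (tetrahedra_at D) + of_bool (card (tetrahedra_at D) = 1))
      = (\<Sum>D\<in>simplices_of_card 3. 2)"
    using assms by (intro sum.cong) (auto simp: pseudomanifold_def)
  moreover have "(\<Sum>D\<in>simplices_of_card 3. of_bool (card (tetrahedra_at D) = 1) :: nat) = card boundary_faces"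
    by (simp add: boundary_faces_def Int_def sum.If_cases of_bool_def)
  ultimately show ?thesis by (simp add: sum.distrib sum_tetrahedra_at)
qed

end

lemma conforming_mesh_complex:
  assumes "conforming_mesh \<Omega> \<T>"
  shows "tetrahedral_complex \<T>" "tetrahedral_complex.pseudomanifold \<T>"
proof -
  have triangulation: "conforming_triangulation \<Omega> \<T>"
    using assms by (simp add: conforming_mesh_def)
  then have simplex: "3 simplex t" if "t \<in> \<T>" for t
    using that by (simp add: conforming_triangulation_def)
  have common: "\<forall>s\<in>\<T>. \<forall>t\<in>\<T>. s \<noteq> t \<longrightarrow>
        s \<inter> t = {} \<or> (\<exists>v. s \<inter> t = {v} \<and> v extreme_point_of s \<and> v extreme_point_of t) \<or>
        (s \<inter> t edge_of s \<and> s \<inter> t edge_of t) \<or> (s \<inter> t facet_of s \<and> s \<inter> t facet_of t)"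
    using triangulation by (simp add: conforming_triangulation_def)
  show tc: "tetrahedral_complex \<T>"
  proof
    fix s t assume st: "s \<in> \<T>" "t \<in> \<T>"
    show "s \<inter> t face_of s"
    proof (cases "s = t")
      case True
      then show ?thesis using face_of_refl[OF convex_simplex[OF simplex[OF st(1)]]] by simp
    next
      case False
      from common[rule_format, OF st this] show ?thesis
      proof (elim disjE exE conjE)
        fix v assume "s \<inter> t = {v}" "v extreme_point_of s"
        then show ?thesis by (simp add: face_of_singleton)
      qed (auto simp: edge_of_def facet_of_def)
    qed
  qed (use triangulation in \<open>simp_all add: conforming_triangulation_def\<close>)
  interpret tetrahedral_complex \<T> by fact
  show pseudomanifold
    unfolding pseudomanifold_def
  proof
    fix D assume D: "D \<in> simplices_of_card 3"
    have "{t \<in> \<T>. convex hull D facet_of t} = tetrahedra_at D"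
      using facet_iff[OF D] by (auto simp: tetrahedra_at_def)
    moreover have "convex hull D \<in> mesh_faces \<T>" using D by (simp add: mesh_faces_eq)
    ultimately show "card (tetrahedra_at D) \<in> {1, 2}"
      using assms by (cases "convex hull D \<subseteq> frontier \<Omega>")
        (auto simp: conforming_mesh_def mesh_conventions_def)
  qed
qed

locale uniform_refinement =
  coarse: tetrahedral_complex T + fine: tetrahedral_complex T' for T T' +
  assumes pseudo: "coarse.pseudomanifold" "fine.pseudomanifold"
    and refines: "mesh_refines T' T"
    and splits: "uniform_splitting T T'"
    and midpoints: "midpoint_vertices T T'"
begin

lemma same_union: "\<Union>T' = \<Union>T" and parent: "t' \<in> T' \<Longrightarrow> \<exists>t\<in>T. t' \<subseteq> t"
  using refines by (auto simp: mesh_refines_def)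

lemma children: 
  assumes "t \<in> T"
  shows "card {t' \<in> T'. t' \<subseteq> t} = 8" "\<Union>{t' \<in> T'. t' \<subseteq> t} = t"
  using splits assms by (auto simp: uniform_splitting_def split_into_def)

lemma card_fine_tetrahedra: "card T' = 8 * card T"
proof -
  have "(\<Sum>t\<in>T. card {t' \<in> T'. t' \<subseteq> t}) = (\<Sum>t'\<in>T'. 1)"
  proof (rule sum_multicount_gen)
    show "\<forall>t'\<in>T'. card {t \<in> T. t' \<subseteq> t} = 1"
    proof
      fix t' assume t': "t' \<in> T'"
      then obtain t where t: "t \<in> T" "t' \<subseteq> t" using parent by blast
      have "{t \<in> T. t' \<subseteq> t} = {t}"
        using t coarse.small_tetrahedron_subset_unique fine.aff_dim_tetrahedron[OF t'] by blast
      then show "card {t \<in> T. t' \<subseteq> t} = 1" by simp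
    qed
  qed (simp_all add: coarse.finite_T fine.finite_T)
  then show ?thesis using children(1) by simp
qed

text \<open>The barycentres of the old vertices and edges are vertices of the refined mesh.  They are distinct because
  they lie in disjoint open simplices.\<close>

lemma card_fine_vertices:
  "card (coarse.simplices_of_card 1) + card (coarse.simplices_of_card 2) \<le> card (fine.simplices_of_card 1)"
proof -
  let ?S = "coarse.simplices_of_card 1 \<union> coarse.simplices_of_card 2"
  define b where "b D = (\<Sum>v\<in>D. (1 / real (card D)) *\<^sub>R v)" for D :: "(real^3) set"
  have bary: "b D \<in> rel_interior (convex hull D)" if "D \<in> coarse.simplices" for D
  proof -
    have "card D > 0" "finite D" using coarse.simplicesD that by auto
    then show ?thesis
      unfolding b_def by (intro subsetD[OF explicit_subset_rel_interior_convex_hull_minimal])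
        (auto intro!: exI[of _ "\<lambda>_. 1 / real (card D)"])
  qed
  have S: "?S \<subseteq> coarse.simplices" by (auto simp: coarse.simplices_of_card_def)
  have "inj_on b ?S"
    using bary S coarse.open_simplices_disjoint by (intro inj_onI) (metis subsetD)
  moreover have "b ` ?S \<subseteq> mesh_vertices T'"
  proof
    fix y assume "y \<in> b ` ?S"
    then consider D where "D \<in> coarse.simplices_of_card 1" "y = b D"
      | D where "D \<in> coarse.simplices_of_card 2" "y = b D" by blast
    then show "y \<in> mesh_vertices T'"
    proof cases
      case 1
      then show ?thesis
        using midpoints unfolding coarse.vertices_eq midpoint_vertices_def by (auto simp: b_def)
    next
      case 2
      then have "card D = 2" by (simp add: coarse.simplices_of_card_def)
      then obtain p q where D: "D = {p, q}" "p \<noteq> q" by (auto simp: card_2_iff)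
      then have "y = midpoint p q" using 2 by (simp add: b_def midpoint_def scaleR_add_right)
      moreover have "closed_segment p q \<in> mesh_edges T"
        using 2 D by (simp add: coarse.mesh_edges_eq segment_convex_hull)
      ultimately show ?thesis using midpoints unfolding midpoint_vertices_def by blast
    qed
  qed
  ultimately have "card ?S \<le> card (mesh_vertices T')"
    by (rule card_inj_on_le) (rule fine.finite_vertices)
  moreover have "card ?S = card (coarse.simplices_of_card 1) + card (coarse.simplices_of_card 2)"
    by (rule card_Un_disjoint) (simp, simp, auto simp: coarse.simplices_of_card_def)
  ultimately show ?thesis by (simp add: fine.card_vertices)
qed

text \<open>A refined face \<open>D'\<close> with only one tetrahedron \<open>t'\<close> does not run through the interior of the old
  tetrahedron \<open>t\<close> containing \<open>t'\<close>, so it lies in an old face \<open>D\<close>.  If \<open>D\<close> had tetrahedra on both sides, each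
  would contain a refined tetrahedron with the face \<open>D'\<close>; these would be distinct.\<close>

lemma fine_boundary_face_in_coarse:
  assumes D': "D' \<in> fine.boundary_faces"
  shows "\<exists>D\<in>coarse.boundary_faces. convex hull D' \<subseteq> convex hull D"
proof -
  have Ds: "D' \<in> fine.simplices" "card D' = 3" "card (fine.tetrahedra_at D') = 1"
    using D' by (auto simp: fine.boundary_faces_def fine.simplices_of_card_def)
  obtain x where x: "x \<in> rel_interior (convex hull D')"
    using fine.rel_interior_hull_nonempty[OF Ds(1)] by blast
  obtain t' where t': "fine.tetrahedra_at D' = {t'}" using Ds(3) by (auto simp: card_1_singleton_iff)
  then have t'T: "t' \<in> T'" "D' \<subseteq> corners t'" by (auto simp: fine.tetrahedra_at_def)
  then have "convex hull D' \<subseteq> t'" using fine.hull_face_iff[OF Ds(1)] face_of_imp_subset by blast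
  moreover obtain t where t: "t \<in> T" "t' \<subseteq> t" using parent t'T by blast
  ultimately have sub: "convex hull D' \<subseteq> t" by blast
  have "x \<notin> interior t"
    using fine.boundary_face_not_interior[OF D' x] interior_mono[of t "\<Union>T"] t(1) same_union by auto
  moreover have "rel_interior t = interior t"
    using coarse.aff_dim_tetrahedron[OF t(1)] aff_dim_eq_full[of t] rel_interior_interior[of t] by simp
  moreover have "x \<in> t" using sub x rel_interior_subset by blast
  ultimately have "x \<in> t - rel_interior t" by simp
  then obtain f where f: "f facet_of t" "x \<in> f"
    using rel_boundary_of_polyhedron[OF simplex_imp_polyhedron[OF coarse.tetrahedra[OF t(1)]]] by auto
  obtain D where D: "D \<in> coarse.simplices_of_card 3" "t \<in> coarse.tetrahedra_at D" "f = convex hull D"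
    using coarse.facet_eq_hull[OF t(1) f(1)] by metis
  have sub_f: "convex hull D' \<subseteq> f"
    by (rule subset_of_face_of[OF facet_of_imp_face_of[OF f(1)] sub]) (use x f in auto)
  have "card (coarse.tetrahedra_at D) \<noteq> 2"
  proof
    assume "card (coarse.tetrahedra_at D) = 2"
    then obtain s where s: "s \<in> coarse.tetrahedra_at D" "s \<noteq> t"
      using D(2) by (auto simp: card_2_iff)
    have child: "\<exists>r'\<in>fine.tetrahedra_at D'. r' \<subseteq> r" if r: "r \<in> coarse.tetrahedra_at D" for r
    proof -
      have rT: "r \<in> T" using r by (simp add: coarse.tetrahedra_at_def)
      have "convex hull D face_of r" using r D(1) coarse.hull_face_iff
        by (auto simp: coarse.tetrahedra_at_def coarse.simplices_of_card_def)
      then have "x \<in> r" using f(2) D(3) face_of_imp_subset by blast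
      then obtain r' where "r' \<in> T'" "r' \<subseteq> r" "x \<in> r'" using children(2)[OF rT] by blast
      then show ?thesis using fine.corners_if_meets[OF Ds(1) _ x] by (auto simp: fine.tetrahedra_at_def)
    qed
    have "t' \<subseteq> s" using child[OF s(1)] t' by simp
    then have "s = t"
      using coarse.small_tetrahedron_subset_unique[of s t t'] s(1) t fine.aff_dim_tetrahedron[OF t'T(1)]
      by (simp add: coarse.tetrahedra_at_def)
    then show False using s(2) by simp
  qed
  then have "D \<in> coarse.boundary_faces"
    using D(1) pseudo(1) by (auto simp: coarse.pseudomanifold_def coarse.boundary_faces_def)
  then show ?thesis using sub_f D(3) by blast
qed

lemma card_fine_boundary_faces: "card fine.boundary_faces \<le> 4 * card coarse.boundary_faces"
proof -
  define B where "B D = {D' \<in> fine.simplices_of_card 3. convex hull D' \<subseteq> convex hull D}" for D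
  have card_B: "card (B D) = 4" if "D \<in> coarse.simplices_of_card 3" for D
  proof -
    have "convex hull D \<in> mesh_faces T" using that by (simp add: coarse.mesh_faces_eq)
    then have "card {f \<in> mesh_faces T'. f \<subseteq> convex hull D} = 4"
      using splits by (auto simp: uniform_splitting_def split_into_def)
    moreover have "{f \<in> mesh_faces T'. f \<subseteq> convex hull D} = (hull) convex ` B D"
      by (auto simp: fine.mesh_faces_eq B_def)
    moreover have "inj_on ((hull) convex) (B D)"
      by (rule inj_on_subset[OF fine.inj_on_hull]) (auto simp: B_def fine.simplices_of_card_def)
    ultimately show ?thesis by (simp add: card_image)
  qed
  have fin: "finite coarse.boundary_faces" by (simp add: coarse.boundary_faces_def)
  have "fine.boundary_faces \<subseteq> (\<Union>D\<in>coarse.boundary_faces. B D)"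
    using fine_boundary_face_in_coarse by (force simp: B_def fine.boundary_faces_def)
  then have "card fine.boundary_faces \<le> card (\<Union>D\<in>coarse.boundary_faces. B D)"
    using fin by (intro card_mono) (auto simp: B_def)
  also have "\<dots> \<le> (\<Sum>D\<in>coarse.boundary_faces. card (B D))" by (rule card_UN_le[OF fin])
  also have "\<dots> = (\<Sum>D\<in>coarse.boundary_faces. 4)"
    by (intro sum.cong card_B) (auto simp: coarse.boundary_faces_def)
  finally show ?thesis by simp
qed

text \<open>With primes for the refined mesh and \<open>B\<close> for the number of faces in one tetrahedron only, invariance of
  \<open>V - E + F - T\<close> and \<open>F' = (4 T' + B') / 2 \<le> 16 T + 2 B\<close> yield
  \<open>E' \<le> V' - V + E + 9 T + 2 B - F = V' - V + E + 7 T + 3 B / 2\<close>.  Here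
  \<open>7 T + 3 B / 2 \<le> 7 (4 T + B) / 4 = 7 F / 2 \<le> 7 E\<close>, and finally \<open>V' - V + 8 E \<le> V' + 8 (V + E) \<le> 9 V'\<close>.\<close>

theorem fine_edges_le: "card (fine.simplices_of_card 2) \<le> 9 * card (fine.simplices_of_card 1)"
  using euler_invariant[OF coarse.tetrahedral_complex_axioms fine.tetrahedral_complex_axioms same_union[symmetric]]
    coarse.double_count_faces[OF pseudo(1)] fine.double_count_faces[OF pseudo(2)]
    card_fine_tetrahedra card_fine_vertices card_fine_boundary_faces coarse.card_faces_le
  unfolding coarse.euler_eq fine.euler_eq coarse.card_tetrahedra fine.card_tetrahedra
  by linarith

corollary average_degree_le: "average_degree T' \<le> 18"
proof (cases "card (fine.simplices_of_card 1) = 0")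
  case False
  then show ?thesis
    using fine_edges_le unfolding fine.average_degree_eq by (simp add: divide_simps)
qed (simp add: fine.average_degree_eq)

end

section \<open>The average degree of a vertex\<close>

theorem lemma16:
  fixes \<Omega> :: "(real^3) set"
    and chi chi\<^sub>b :: int
    and \<T>\<^sub>0 :: "(real^3) set set"
    and \<R> :: "(real^3) set set \<Rightarrow> (real^3) set set"
    and \<T> :: "nat \<Rightarrow> (real^3) set set"
  assumes "open \<Omega>" and "bounded \<Omega>" and "path_connected \<Omega>" and "\<Omega> \<noteq> {}"
    and "polytopal_boundary \<Omega>"
    and "chi = Euler_characteristic (top_of_set (closure \<Omega>))"
    and "chi\<^sub>b = Euler_characteristic (top_of_set (frontier \<Omega>))"
    and "conforming_mesh \<Omega> \<T>\<^sub>0"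
    and "\<exists>v\<in>mesh_vertices \<T>\<^sub>0. v \<notin> frontier \<Omega>"
    and "uniform_refinement_scheme \<Omega> \<R>"
    and "\<T> 0 = \<T>\<^sub>0"
    and "\<And>n. n \<ge> 1 \<Longrightarrow> \<T> n = \<R> (\<T> (n - 1))"
  shows "(\<forall>n\<ge>1. average_degree (\<T> n) \<le>
            18 + 2 / 15 * max 0 (7 * real_of_int chi + 4 * real_of_int chi\<^sub>b - 96)) \<and>
         (7 * chi + 4 * chi\<^sub>b \<le> 96 \<longrightarrow> (\<forall>n\<ge>1. average_degree (\<T> n) \<le> 18))"
proof -
  have step: "conforming_mesh \<Omega> (\<R> M)" "mesh_refines (\<R> M) M"
      "uniform_splitting M (\<R> M)" "midpoint_vertices M (\<R> M)" if "conforming_mesh \<Omega> M" for M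
    using assms(10) that unfolding uniform_refinement_scheme_def by blast+
  have conforming: "conforming_mesh \<Omega> (\<T> n)" for n
  proof (induction n)
    case 0
    show ?case using assms(8,11) by simp
  next
    case (Suc n)
    have "\<T> (Suc n) = \<R> (\<T> n)" using assms(12)[of "Suc n"] by simp
    then show ?case using step(1)[OF Suc.IH] by simp
  qed
  have bound: "average_degree (\<T> n) \<le> 18" if "n \<ge> 1" for n
  proof -
    have eq: "\<T> n = \<R> (\<T> (n - 1))" by (rule assms(12)[OF that])
    note coarse = conforming_mesh_complex[OF conforming[of "n - 1"]]
    note fine = conforming_mesh_complex[OF conforming[of n]]
    have "uniform_refinement (\<T> (n - 1)) (\<T> n)"
      using coarse fine step(2-4)[OF conforming[of "n - 1"], folded eq]
      by (simp add: uniform_refinement_def uniform_refinement_axioms_def)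
    then show ?thesis by (rule uniform_refinement.average_degree_le)
  qed
  have "average_degree (\<T> n) \<le> 18 + 2 / 15 * max 0 (7 * real_of_int chi + 4 * real_of_int chi\<^sub>b - 96)"
    if "n \<ge> 1" for n
    by (rule add_increasing2[OF _ bound[OF that]]) simp
  then show ?thesis using bound by blast
qed

end
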